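(* Let $k\in\mathbb{N}$, let $f_1,\dots,f_k:\mathbb{R}\to\mathbb{R}$ be non-constant (real) analytic functions and let $a_1,\dots,a_k:\mathbb{N}\to\mathbb{R}$ be scattered sequences. Assume that either (1) the sequences $a_1,\dots,a_k$ are jointly scattered, or (2) the functions $\{1,f_1,\dots,f_k\}$ are linearly independent over $\mathbb{R}$. Then for Lebesgue-almost every $x\in\mathbb{R}$, the sequence $\big(a_1(n)f_1(x),\dots,a_k(n)f_k(x)\big)_{n\in\mathbb{N}}$ is uniformly distributed in $\mathbb{T}^k$.
   Context: $\mathbb{N}=\{1,2,\dots\}$, $\mathbb{T}^k=\mathbb{R}^k/\mathbb{Z}^k$. A sequence $(x_n)_{n\in\mathbb{N}}$ in $\mathbb{R}^k$ is uniformly distributed in $\mathbb{T}^k$ (equivalently, uniformly distributed modulo 1) if for all intervals $I_1,\dots,I_k\subset[0,1]$, $\lim_{N\to\infty}\frac1N|\{n\in\{1,\dots,N\}:\{x_n\}\in I_1\times\cdots\times I_k\}|=\mu(I_1\times\cdots\times I_k)$, where $\mu$ is $k$-dimensional Lebesgue measure and $\{y\}$ is the vector of coordinatewise fractional parts of $y\in\mathbb{R}^k$. For $\delta\in(0,1]$, a sequence $a:\mathbb{N}\to\mathbb{R}$ is $\delta$-scattered if there exists $\epsilon>0$ such that for every sufficiently large $N$, $\frac1{N^2}\sum_{1\le m<n\le N}\min\big(|a(n)-a(m)|^{-\delta},1\big)\le\frac1{(\log N)^{1+\epsilon}}$ (with the term equal to $1$ when $a(n)=a(m)$). The sequence $a$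 is scattered if it is $\delta$-scattered for every $\delta\in(0,1]$. Sequences $a_1,\dots,a_k:\mathbb{N}\to\mathbb{R}$ are jointly scattered if for every non-zero $v=(v_1,\dots,v_k)\in\mathbb{R}^k$ the sequence $v_1a_1+\cdots+v_ka_k$ is scattered. Linear independence of $\{1,f_1,\dots,f_k\}$ is meant for the family (no nontrivial real linear combination of $1,f_1,\dots,f_k$ vanishes identically). *)

theory Defs
  imports "HOL-Analysis.Analysis"
begin

text \<open>
  Sequences indexed by \<open>{1, 2, \<dots>}\<close> are functions on \<^typ>\<open>nat\<close> whose value at \<open>0\<close> is never
  inspected; \<open>k\<close>-tuples are indexed by a finite type \<open>'k\<close>, so that \<open>k\<close> is \<open>CARD('k) \<ge> 1\<close>.
\<close>

definition real_analytic :: "(real \<Rightarrow> real) \<Rightarrow> bool" where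
  "real_analytic f \<longleftrightarrow>
    (\<forall>x0. \<exists>r>0. \<exists>c :: nat \<Rightarrow> real. \<forall>x. \<bar>x - x0\<bar> < r \<longrightarrow> (\<lambda>n. c n * (x - x0) ^ n) sums f x)"

text \<open>
  The intervals may be open, closed, half-open or degenerate. The predicate
  \<^const>\<open>is_interval\<close> also admits the empty set, for which the limit is trivially correct.
\<close>

definition uniformly_distributed_mod1 :: "(nat \<Rightarrow> real ^ 'k) \<Rightarrow> bool" where
  "uniformly_distributed_mod1 x \<longleftrightarrow>
    (\<forall>I :: 'k \<Rightarrow> real set. (\<forall>j. is_interval (I j) \<and> I j \<subseteq> {0..1}) \<longrightarrow>
      (\<lambda>N. real (card {n \<in> {1..N}. (\<chi> j. frac (x n $ j)) \<in> {y :: real ^ 'k. \<forall>j. y $ j \<in> I j}}) / real N)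
        \<longlonglongrightarrow> measure lebesgue {y :: real ^ 'k. \<forall>j. y $ j \<in> I j})"

text \<open>
  The case distinction is needed because \<open>0 powr (- \<delta>) = 0\<close> in HOL, whereas the term
  for \<open>a n = a m\<close> is meant to be \<open>1\<close>.
\<close>

definition delta_scattered :: "real \<Rightarrow> (nat \<Rightarrow> real) \<Rightarrow> bool" where
  "delta_scattered \<delta> a \<longleftrightarrow>
    (\<exists>\<epsilon>>0. \<forall>\<^sub>F N in sequentially.
      1 / (real N)\<^sup>2 *
        (\<Sum>(m, n) \<in> {(m, n). 1 \<le> m \<and> m < n \<and> n \<le> N}.
          if a n = a m then 1 else min (\<bar>a n - a m\<bar> powr (- \<delta>)) 1)
      \<le> 1 / ln (real N) powr (1 + \<epsilon>))"

definition scattered :: "(nat \<Rightarrow> real) \<Rightarrow> bool" where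
  "scattered a \<longleftrightarrow> (\<forall>\<delta>\<in>{0<..1}. delta_scattered \<delta> a)"

definition jointly_scattered :: "('k::finite \<Rightarrow> nat \<Rightarrow> real) \<Rightarrow> bool" where
  "jointly_scattered a \<longleftrightarrow> (\<forall>v :: real ^ 'k. v \<noteq> 0 \<longrightarrow> scattered (\<lambda>n. \<Sum>i\<in>UNIV. v $ i * a i n))"

text \<open>
  Linear independence over the reals of a family (not of its range: a repeated function makes
  the family dependent).
\<close>

definition lin_indep_family :: "('i::finite \<Rightarrow> real \<Rightarrow> real) \<Rightarrow> bool" where
  "lin_indep_family g \<longleftrightarrow>
    (\<forall>c :: 'i \<Rightarrow> real. (\<forall>x. (\<Sum>i\<in>UNIV. c i * g i x) = 0) \<longrightarrow> (\<forall>i. c i = 0))"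

text \<open>The family \<open>1, f\<^sub>1, \<dots>, f\<^sub>k\<close>, with the constant function \<open>1\<close> at index \<^const>\<open>None\<close>.\<close>

definition adjoin_one :: "('k \<Rightarrow> real \<Rightarrow> real) \<Rightarrow> 'k option \<Rightarrow> real \<Rightarrow> real" where
  "adjoin_one f j = (case j of None \<Rightarrow> (\<lambda>x. 1) | Some i \<Rightarrow> f i)"

end

(*
By Weyl's criterion it suffices that for every non-zero integer vector h and almost every x the
averages of cis (2 pi (sum_i h_i a_i(n) f_i(x))) tend to 0. Expanding the square of such an average
and integrating over a short interval gives oscillatory integrals with phase sum_i c_i f_i, where
c_i = 2 pi h_i (a_i(m) - a_i(n)). Let V be the space of c for which sum_i c_i f_i is constant. By
analyticity, for each unit vector of the orthogonal complement of V some derivative of positive order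
is non-zero at a given point; compactness makes this uniform, and van der Corput's method bounds the
integral near the point by a negative power of any component of c orthogonal to V. Under either
alternative one such component is the difference b(m) - b(n) of a scattered sequence b, so the mean
squares are O(1 / (log N)^(1 + e)). They are summable along a subsequence N_j with N_(j+1) / N_j
tending to 1, which yields convergence almost everywhere.
*)
theory Submission
  imports Defs "HOL-Real_Asymp.Real_Asymp"
begin

section \<open>Real analytic functions\<close>

text \<open>The exponent of decay at a point depends on the orders of the derivatives that do not
  vanish there and cannot be prescribed; hence scatteredness enters for arbitrarily small
  \<open>\<delta>\<close>. Exponent, constant and interval may vary with the point, since an almost
  everywhere statement is local. Under the first alternative 1, f_1, ..., f_k may be dependent. Then
  a large c can give a constant phase, and no bound in terms of the norm of c is possible; only a
  component along some w0 orthogonal to V survives. The sequence b has the coefficients w0_i * 2 pi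
  h_i, which must not all vanish. Take i with h_i non-zero: f_i is not constant, so the i-th unit
  vector lies outside V and its projection w0 to the orthogonal complement has a non-zero i-th
  coordinate. Under the second alternative V = 0, and w0 can single out one a_i. The exponent 1 + e
  of the logarithm is what the subsequence can afford: for N_j near exp(j^s) the ratios tend to 1
  because s < 1, while the mean squares, of order j^(-s(1 + e)), are summable if s(1 + e) >
  1.\<close>

lemma analytic_series_deriv:
  fixes f :: "real \<Rightarrow> real"
  assumes f: "\<And>y. \<bar>y - x0\<bar> < r \<Longrightarrow> (\<lambda>n. c n * (y - x0) ^ n) sums f y"
    and x: "\<bar>x - x0\<bar> < r"
  shows "(f has_real_derivative deriv f x) (at x)"
    and "(\<lambda>n. diffs c n * (x - x0) ^ n) sums deriv f x"
proof -
  have sm: "summable (\<lambda>n. c n * z ^ n)" if "norm z < r" for z :: real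
    using f[of "x0 + z"] that by (auto simp: sums_iff)
  have d: "((\<lambda>z. \<Sum>n. c n * z ^ n) has_field_derivative (\<Sum>n. diffs c n * (x - x0) ^ n))
      (at (x - x0))"
    using sm x by (intro termdiffs_strong'[where K = r]) auto
  have "((\<lambda>y. \<Sum>n. c n * (y - x0) ^ n) has_field_derivative (\<Sum>n. diffs c n * (x - x0) ^ n)) (at x)"
    using DERIV_shift[of "\<lambda>z. \<Sum>n. c n * z ^ n" _ "x" "- x0"] d by simp
  then have D: "(f has_real_derivative (\<Sum>n. diffs c n * (x - x0) ^ n)) (at x)"
  proof (rule DERIV_cong_ev[THEN iffD1, rotated -1])
    have "\<forall>\<^sub>F y in nhds x. y \<in> {x0 - r <..< x0 + r}"
      using x by (intro eventually_nhds_in_open) auto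
    then show "\<forall>\<^sub>F y in nhds x. (\<Sum>n. c n * (y - x0) ^ n) = f y"
      by eventually_elim (use f in \<open>auto simp: sums_iff abs_less_iff\<close>)
  qed auto
  then show "(f has_real_derivative deriv f x) (at x)"
    using DERIV_imp_deriv[OF D] by simp
  have "summable (\<lambda>n. diffs c n * (x - x0) ^ n)"
    by (rule termdiff_converges[OF _ sm]) (use x in auto)
  then show "(\<lambda>n. diffs c n * (x - x0) ^ n) sums deriv f x"
    using DERIV_imp_deriv[OF D] by (simp add: sums_iff)
qed

lemma real_analytic_DERIV:
  assumes "real_analytic f"
  shows "(f has_real_derivative deriv f x) (at x)"
proof -
  obtain r c where "r > 0" and "\<And>y. \<bar>y - x\<bar> < r \<Longrightarrow> (\<lambda>n. c n * (y - x) ^ n) sums f y"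
    using assms[unfolded real_analytic_def, rule_format, of x] by blast
  then show ?thesis
    by (intro analytic_series_deriv(1)[of x r c f x]) auto
qed

lemma real_analytic_deriv:
  assumes "real_analytic f"
  shows "real_analytic (deriv f)"
  unfolding real_analytic_def
proof
  fix x0
  obtain r c where r: "r > 0" and "\<And>y. \<bar>y - x0\<bar> < r \<Longrightarrow> (\<lambda>n. c n * (y - x0) ^ n) sums f y"
    using assms[unfolded real_analytic_def, rule_format, of x0] by blast
  then have "\<forall>x. \<bar>x - x0\<bar> < r \<longrightarrow> (\<lambda>n. diffs c n * (x - x0) ^ n) sums deriv f x"
    using analytic_series_deriv(2)[of x0 r c f] by simp
  with r show "\<exists>r>0. \<exists>c. \<forall>x. \<bar>x - x0\<bar> < r \<longrightarrow> (\<lambda>n. c n * (x - x0) ^ n) sums deriv f x"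
    by blast
qed

lemma real_analytic_deriv_funpow:
  "real_analytic f \<Longrightarrow> real_analytic ((deriv ^^ j) f)"
  by (induction j) (auto intro: real_analytic_deriv)

lemma real_analytic_DERIV_funpow:
  assumes "real_analytic f"
  shows "((deriv ^^ j) f has_real_derivative (deriv ^^ Suc j) f x) (at x)"
  using real_analytic_DERIV[OF real_analytic_deriv_funpow[OF assms]] by simp

lemma continuous_on_real_analytic_funpow:
  assumes "real_analytic f"
  shows "continuous_on S ((deriv ^^ j) f)"
  by (rule DERIV_continuous_on[OF has_field_derivative_at_within[OF real_analytic_DERIV_funpow[OF assms]]])

text \<open>Differentiation replaces the coefficients \<open>c\<close> by \<open>diffs c\<close> on
  the same interval, so the induction moves \<open>f\<close> and \<open>c\<close> together and picks
  up one factor of the factorial at each order.\<close>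

lemma analytic_series_coeff:
  fixes f :: "real \<Rightarrow> real"
  assumes "\<And>y. \<bar>y - x0\<bar> < r \<Longrightarrow> (\<lambda>n. c n * (y - x0) ^ n) sums f y" and "r > 0"
  shows "(deriv ^^ j) f x0 = fact j * c j"
  using assms(1)
proof (induction j arbitrary: f c)
  case 0
  then have "(\<lambda>n. c n * 0 ^ n) sums f x0"
    using \<open>r > 0\<close> "0.prems"[of x0] by simp
  moreover have "(\<lambda>n. c n * 0 ^ n) sums c 0"
    using powser_sums_zero by blast
  ultimately show ?case
    using sums_unique2 by auto
next
  case (Suc j)
  have "(deriv ^^ j) (deriv f) x0 = fact j * diffs c j"
    using Suc.IH analytic_series_deriv(2)[OF Suc.prems] by blast
  then show ?case
    by (simp add: funpow_Suc_right diffs_def del: funpow.simps)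
qed

text \<open>Identity theorem by connectedness of the line: the set where all derivatives vanish is
  closed because each derivative is continuous, and open because the power series around such a
  point has only zero coefficients.\<close>

lemma real_analytic_eq_0:
  assumes f: "real_analytic f" and x0: "\<And>j. (deriv ^^ j) f x0 = 0"
  shows "f x = 0"
proof -
  define Z where "Z = {x. \<forall>j. (deriv ^^ j) f x = 0}"
  have "Z = (\<Inter>j. (deriv ^^ j) f -` {0})"
    by (auto simp: Z_def)
  moreover have "closed ((deriv ^^ j) f -` {0})" for j
  proof (rule continuous_closed_vimage)
    show "isCont ((deriv ^^ j) f) y" for y
      by (rule DERIV_continuous[OF real_analytic_DERIV_funpow[OF f]])
  qed simp
  ultimately have cl: "closed Z"
    by auto
  have "open Z"
    unfolding open_dist
  proof
    fix z assume z: "z \<in> Z"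
    obtain r c where r: "r > 0" and c: "\<And>y. \<bar>y - z\<bar> < r \<Longrightarrow> (\<lambda>n. c n * (y - z) ^ n) sums f y"
      using f[unfolded real_analytic_def, rule_format, of z] by blast
    have "c j = 0" for j
      using analytic_series_coeff[OF c r, of j] z by (simp add: Z_def)
    then have f0: "f y = 0" if "\<bar>y - z\<bar> < r" for y
      using c[OF that] by (simp add: sums_iff)
    have "y \<in> Z" if y: "\<bar>y - z\<bar> < r" for y
    proof -
      have *: "\<bar>w - z\<bar> < r" if "\<bar>w - y\<bar> < r - \<bar>y - z\<bar>" for w
        using that by linarith
      \<comment> \<open>Around \<open>y\<close> the zero series represents \<open>f\<close> on the
        interval that still fits inside the one around \<open>z\<close>.\<close>
      have "(deriv ^^ j) f y = fact j * 0" for j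
        by (rule analytic_series_coeff[where r = "r - \<bar>y - z\<bar>"]) (use f0 * y in auto)
      then show ?thesis
        by (simp add: Z_def)
    qed
    then show "\<exists>e>0. \<forall>y. dist y z < e \<longrightarrow> y \<in> Z"
      using r by (auto simp: dist_real_def)
  qed
  with cl have "Z = {} \<or> Z = UNIV"
    using clopen by blast
  moreover have "x0 \<in> Z"
    using x0 by (simp add: Z_def)
  ultimately have "x \<in> Z"
    by auto
  then show ?thesis
    by (auto simp: Z_def dest: spec[of _ 0])
qed

lemma real_analytic_linear_combination:
  fixes f :: "'k::finite \<Rightarrow> real \<Rightarrow> real"
  assumes "\<And>i. real_analytic (f i)"
  shows "real_analytic (\<lambda>x. \<Sum>i\<in>UNIV. u i * f i x)"
  unfolding real_analytic_def
proof
  fix x0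
  have r': "\<forall>i. \<exists>r>0. \<exists>c. \<forall>x. \<bar>x - x0\<bar> < r \<longrightarrow> (\<lambda>n. c n * (x - x0) ^ n) sums f i x"
    using assms[unfolded real_analytic_def] by blast
  obtain r c where r: "\<And>i. r i > 0"
    and c: "\<And>i x. \<bar>x - x0\<bar> < r i \<Longrightarrow> (\<lambda>n. c i n * (x - x0) ^ n) sums f i x"
    using r' by metis
  have "(\<lambda>n. (\<Sum>i\<in>UNIV. u i * c i n) * (x - x0) ^ n) sums (\<Sum>i\<in>UNIV. u i * f i x)"
    if "\<bar>x - x0\<bar> < Min (range r)" for x
  proof -
    have "(\<lambda>n. \<Sum>i\<in>UNIV. u i * (c i n * (x - x0) ^ n)) sums (\<Sum>i\<in>UNIV. u i * f i x)"
    proof (rule sums_sum, rule sums_mult, rule c)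
      fix i
      have "Min (range r) \<le> r i"
        by simp
      then show "\<bar>x - x0\<bar> < r i"
        using that by linarith
    qed
    then show ?thesis
      by (simp add: sum_distrib_right mult.assoc)
  qed
  moreover have "Min (range r) > 0"
    using r by simp
  ultimately show "\<exists>r>0. \<exists>c. \<forall>x. \<bar>x - x0\<bar> < r \<longrightarrow>
      (\<lambda>n. c n * (x - x0) ^ n) sums (\<Sum>i\<in>UNIV. u i * f i x)"
    by (intro exI[of _ "Min (range r)"] conjI exI[of _ "\<lambda>n. \<Sum>i\<in>UNIV. u i * c i n"] allI impI)
qed

lemma deriv_funpow_linear_combination:
  fixes f :: "'k::finite \<Rightarrow> real \<Rightarrow> real"
  assumes "\<And>i. real_analytic (f i)"
  shows "(deriv ^^ j) (\<lambda>x. \<Sum>i\<in>UNIV. u i * f i x) = (\<lambda>x. \<Sum>i\<in>UNIV. u i * (deriv ^^ j) (f i) x)"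
proof (induction j)
  case (Suc j)
  show ?case
  proof
    fix x
    have "((\<lambda>x. \<Sum>i\<in>UNIV. u i * (deriv ^^ j) (f i) x) has_real_derivative
        (\<Sum>i\<in>UNIV. u i * (deriv ^^ Suc j) (f i) x)) (at x)"
      by (rule DERIV_sum) (rule DERIV_cmult[OF real_analytic_DERIV_funpow[OF assms]])
    then show "(deriv ^^ Suc j) (\<lambda>x. \<Sum>i\<in>UNIV. u i * f i x) x
        = (\<Sum>i\<in>UNIV. u i * (deriv ^^ Suc j) (f i) x)"
      unfolding funpow.simps(2)[of j] o_apply Suc.IH by (rule DERIV_imp_deriv)
  qed
qed simp

section \<open>Oscillatory integrals\<close>

text \<open>Integration by parts against 1 / G'. The boundary terms cost 2 / (t l) and the remaining
  integral M / (t l^2); \<open>l \<le> 1\<close> and \<open>b - a \<le> 1\<close> merge them into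
  one bound.\<close>

lemma van_der_Corput_first_derivative:
  fixes G G' G'' :: "real \<Rightarrow> real"
  assumes ab: "a \<le> b" "b - a \<le> 1"
    and G: "\<And>x. (G has_real_derivative G' x) (at x)"
    and G': "\<And>x. (G' has_real_derivative G'' x) (at x)"
    and G'': "continuous_on UNIV G''"
    and M: "\<And>x. x \<in> {a..b} \<Longrightarrow> \<bar>G'' x\<bar> \<le> M"
    and l: "\<And>x. x \<in> {a..b} \<Longrightarrow> l \<le> \<bar>G' x\<bar>" "0 < l" "l \<le> 1"
    and t: "0 < t"
  shows "norm (integral {a..b} (\<lambda>x. cis (t * G x))) \<le> (M + 2) / (t * l\<^sup>2)"
proof -
  \<comment> \<open>\<open>u\<close> is cis(t G) / (i t G'), and \<open>e\<close> is the part of its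
    derivative that comes from differentiating 1 / G'; thus u' = cis(t G) + e.\<close>
  define u where "u = (\<lambda>x. of_real (1 / (t * G' x)) * (- \<i> * cis (t * G x)))"
  define e where "e = (\<lambda>x. of_real (- G'' x / (t * (G' x)\<^sup>2)) * (- \<i> * cis (t * G x)))"
  have G'0: "G' x \<noteq> 0" if "x \<in> {a..b}" for x
    using l that by force
  have cG: "continuous_on S G" "continuous_on S G'" "continuous_on S G''" for S
    using DERIV_continuous[OF G] DERIV_continuous[OF G'] continuous_on_subset[OF G'']
    by (auto intro: continuous_at_imp_continuous_on)
  have du: "(u has_vector_derivative (cis (t * G x) + e x)) (at x within {a..b})"
    if x: "x \<in> {a..b}" for x
  proof -
    have 1: "((\<lambda>x. of_real (1 / (t * G' x)) :: complex) has_vector_derivative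
        of_real (- G'' x / (t * (G' x)\<^sup>2))) (at x within {a..b})"
      apply (rule has_vector_derivative_of_real)
      using G'0[OF x] t DERIV_subset[OF G'[of x]]
      by (auto intro!: derivative_eq_intros
          simp: has_real_derivative_iff_has_vector_derivative[symmetric] power2_eq_square field_simps)
    have g: "((\<lambda>x. t * G x) has_real_derivative t * G' x) (at x within {a..b})"
      using DERIV_cmult[OF DERIV_subset[OF G[of x]]] by auto
    have "((\<lambda>x. cis (t * G x)) has_vector_derivative (t * G' x) *\<^sub>R (\<i> * cis (t * G x)))
        (at x within {a..b})"
      using has_derivative_cis[OF g[unfolded has_field_derivative_def]]
      by (simp add: has_vector_derivative_def algebra_simps)
    then have 2: "((\<lambda>x. - \<i> * cis (t * G x)) has_vector_derivative of_real (t * G' x) * cis (t * G x))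
        (at x within {a..b})"
      using has_vector_derivative_mult_right[of "\<lambda>x. cis (t * G x)" _ "at x within {a..b}" "-\<i>"]
      by (fastforce simp: scaleR_conv_of_real algebra_simps)
    have nz: "of_real (1 / (t * G' x)) * (of_real (t * G' x) * cis (t * G x)) = cis (t * G x)"
      using G'0[OF x] t by (simp add: field_simps)
    show ?thesis
      unfolding u_def e_def
      using has_vector_derivative_mult[OF 1 2] unfolding nz by (simp add: add.commute)
  qed
  have "((\<lambda>x. cis (t * G x) + e x) has_integral (u b - u a)) {a..b}"
    by (rule fundamental_theorem_of_calculus[OF ab(1) du])
  moreover have "continuous_on {a..b} e"
    unfolding e_def using G'0 t by (intro continuous_intros cG) auto
  then have ie: "e integrable_on {a..b}"
    by (rule integrable_continuous_real)
  moreover have ic: "(\<lambda>x. cis (t * G x)) integrable_on {a..b}"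
    by (intro integrable_continuous_real continuous_intros cG)
  ultimately have eq: "integral {a..b} (\<lambda>x. cis (t * G x)) = u b - u a - integral {a..b} e"
    using integral_add[OF ic ie] by (simp add: has_integral_iff eq_diff_eq)
  have inv: "1 / (t * \<bar>G' x\<bar>) \<le> 1 / (t * l\<^sup>2)" "1 / (t * (G' x)\<^sup>2) \<le> 1 / (t * l\<^sup>2)"
    if "x \<in> {a..b}" for x
  proof -
    have "l\<^sup>2 \<le> l"
      using l by (simp add: power2_eq_square mult_left_le)
    then have "l\<^sup>2 \<le> \<bar>G' x\<bar>"
      using l(1)[OF that] by linarith
    then show "1 / (t * \<bar>G' x\<bar>) \<le> 1 / (t * l\<^sup>2)"
      using t l G'0[OF that] by (intro divide_left_mono mult_left_mono mult_pos_pos) auto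
    have "l\<^sup>2 \<le> \<bar>G' x\<bar>\<^sup>2"
      using l(1)[OF that] l(2) by (intro power_mono) auto
    then show "1 / (t * (G' x)\<^sup>2) \<le> 1 / (t * l\<^sup>2)"
      using t l G'0[OF that] by (intro divide_left_mono mult_left_mono mult_pos_pos) auto
  qed
  have nu: "norm (u x) \<le> 1 / (t * l\<^sup>2)" if "x \<in> {a..b}" for x
    using inv(1)[OF that] t by (simp add: u_def norm_mult norm_divide abs_mult)
  have ne: "norm (e x) \<le> M / (t * l\<^sup>2)" if "x \<in> {a..b}" for x
  proof -
    have "norm (e x) = \<bar>G'' x\<bar> * (1 / (t * (G' x)\<^sup>2))"
      using t by (simp add: e_def norm_mult norm_divide abs_mult norm_power)
    also have "\<dots> \<le> M * (1 / (t * l\<^sup>2))"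
      using M[OF that] inv(2)[OF that] t by (intro mult_mono) auto
    finally show ?thesis by simp
  qed
  have M0: "M \<ge> 0"
    using M[of a] ab by auto
  have "norm (integral {a..b} e) \<le> M / (t * l\<^sup>2) * (b - a)"
    using integral_bound[OF ab(1) \<open>continuous_on {a..b} e\<close> ne] by blast
  also have "\<dots> \<le> M / (t * l\<^sup>2) * 1"
    using ab M0 t by (intro mult_left_mono) auto
  finally have "norm (integral {a..b} e) \<le> M / (t * l\<^sup>2)"
    by simp
  moreover have "norm (u b - u a - integral {a..b} e) \<le> norm (u b) + norm (u a) + norm (integral {a..b} e)"
    by (meson add_mono norm_triangle_ineq4 norm_triangle_ineq4 order_trans add_right_mono)
  ultimately have "norm (integral {a..b} (\<lambda>x. cis (t * G x)))
      \<le> 1 / (t * l\<^sup>2) + 1 / (t * l\<^sup>2) + M / (t * l\<^sup>2)"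
    unfolding eq using nu[of a] nu[of b] ab by (intro order_trans[OF \<open>norm (u b - u a - _) \<le> _\<close>] add_mono) auto
  also have "\<dots> = (M + 2) / (t * l\<^sup>2)"
    by (simp add: add_divide_distrib)
  finally show ?thesis .
qed

text \<open>If G is below \<open>d\<close> at one point z, the mean value theorem makes it grow at
  rate at least \<open>l\<close> away from z, so beyond distance 2 d / l its modulus is at least 2 d
  - d. The guards \<open>a < p\<close> and \<open>q < b\<close> allow for outer pieces that shrink
  to a point, where the lower bound may fail.\<close>

lemma small_derivative_interval:
  fixes G G' :: "real \<Rightarrow> real"
  assumes ab: "a \<le> b" and G: "\<And>x. (G has_real_derivative G' x) (at x)"
    and l: "\<And>x. x \<in> {a..b} \<Longrightarrow> l \<le> \<bar>G' x\<bar>" "0 < l" and d: "0 < d"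
  obtains p q where "a \<le> p" "p \<le> q" "q \<le> b" "q - p \<le> 4 * d / l"
    "\<And>x. a < p \<Longrightarrow> x \<in> {a..p} \<Longrightarrow> d \<le> \<bar>G x\<bar>" "\<And>x. q < b \<Longrightarrow> x \<in> {q..b} \<Longrightarrow> d \<le> \<bar>G x\<bar>"
proof (cases "\<forall>x\<in>{a..b}. d \<le> \<bar>G x\<bar>")
  case True
  then show ?thesis
    using that[of a a] ab l d by auto
next
  case False
  then obtain z where z: "z \<in> {a..b}" "\<bar>G z\<bar> < d"
    by force
  have mvt: "l * \<bar>x - z\<bar> \<le> \<bar>G x - G z\<bar>" if x: "x \<in> {a..b}" for x
  proof -
    have "\<exists>y\<in>{a..b}. G x - G z = (x - z) * G' y"
    proof (cases x z rule: linorder_cases)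
      case less
      then obtain y where "x < y" "y < z" "G z - G x = (z - x) * G' y"
        using MVT2[of x z G G'] G by auto
      then show ?thesis
        using x z by (intro bexI[of _ y]) (auto simp: algebra_simps)
    next
      case greater
      then obtain y where "z < y" "y < x" "G x - G z = (x - z) * G' y"
        using MVT2[of z x G G'] G by auto
      then show ?thesis
        using x z by (intro bexI[of _ y]) (auto simp: algebra_simps)
    qed (use x in auto)
    then obtain y where "y \<in> {a..b}" "G x - G z = (x - z) * G' y"
      by blast
    then show ?thesis
      using mult_right_mono[OF l(1)[of y], of "\<bar>x - z\<bar>"] by (simp add: abs_mult mult.commute)
  qed
  have far: "d \<le> \<bar>G x\<bar>" if "x \<in> {a..b}" "2 * d / l \<le> \<bar>x - z\<bar>" for x
  proof -
    have "2 * d \<le> l * \<bar>x - z\<bar>"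
      using that(2) l(2) by (simp add: field_simps)
    then show ?thesis
      using mvt[OF that(1)] z(2) by linarith
  qed
  have dl: "0 < d / l"
    using d l by simp
  show ?thesis
    by (rule that[of "max a (z - 2 * d / l)" "min b (z + 2 * d / l)"])
      (use z ab dl in \<open>auto intro!: far simp: max_def min_def split: if_splits\<close>)
qed

text \<open>
  The exponent \<open>1 / 3 ^ k\<close> is far from optimal, but any positive power of \<open>t\<close> suffices here.
  Using a bound on the second derivative avoids the monotonicity hypothesis that the
  classical first-derivative test needs.
\<close>

lemma van_der_Corput:
  fixes G :: "nat \<Rightarrow> real \<Rightarrow> real"
  assumes G: "\<And>j x. (G j has_real_derivative G (Suc j) x) (at x)"
    and ab: "a \<le> b" "b - a \<le> 1"
    and M: "\<And>x. x \<in> {a..b} \<Longrightarrow> \<bar>G 2 x\<bar> \<le> M"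
    and l: "\<And>x. x \<in> {a..b} \<Longrightarrow> l \<le> \<bar>G (Suc k) x\<bar>" "0 < l" "l \<le> 1"
    and t: "1 \<le> t"
  shows "norm (integral {a..b} (\<lambda>x. cis (t * G 0 x))) \<le> ((M + 6) * 2 ^ k - 4) * t powr - (1 / 3 ^ k) / l\<^sup>2"
  using ab M l
proof (induction k arbitrary: a b l)
  case 0
  have "continuous_on UNIV (G 2)"
    by (intro continuous_at_imp_continuous_on ballI DERIV_continuous[OF G])
  then have "norm (integral {a..b} (\<lambda>x. cis (t * G 0 x))) \<le> (M + 2) / (t * l\<^sup>2)"
    using 0 t G
    by (intro van_der_Corput_first_derivative[where G' = "G 1" and G'' = "G 2"])
      (auto simp: numeral_2_eq_2)
  then show ?case
    using t by (simp add: powr_minus field_simps)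
next
  case (Suc k)
  \<comment> \<open>The cube of \<open>d\<close> is \<open>t powr - (1 / 3 ^ k)\<close>. The
    induction hypothesis on the outer pieces loses 1 / d^2 and so yields order \<open>d\<close>, the
    same as the length of the middle piece.\<close>
  define d where "d = t powr - (1 / 3 ^ Suc k)"
  have d: "0 < d" "d \<le> 1"
    using t powr_mono[of "- (1 / 3 ^ Suc k)" 0 t] by (auto simp: d_def)
  obtain p q where pq: "a \<le> p" "p \<le> q" "q \<le> b" "q - p \<le> 4 * d / l"
    and far: "\<And>x. a < p \<Longrightarrow> x \<in> {a..p} \<Longrightarrow> d \<le> \<bar>G (Suc k) x\<bar>"
      "\<And>x. q < b \<Longrightarrow> x \<in> {q..b} \<Longrightarrow> d \<le> \<bar>G (Suc k) x\<bar>"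
    using small_derivative_interval[OF Suc.prems(1) G[of "Suc k"] Suc.prems(4,5) d(1)] by metis
  let ?I = "\<lambda>a b. integral {a..b} (\<lambda>x. cis (t * G 0 x))"
  let ?B = "((M + 6) * 2 ^ k - 4) * t powr - (1 / 3 ^ k) / d\<^sup>2"
  have M0: "M \<ge> 0"
    using Suc.prems(3)[of a] Suc.prems(1) by auto
  have "(M + 6) * 2 ^ k \<ge> 6 * 1"
    using M0 by (intro mult_mono) auto
  then have B0: "?B \<ge> 0"
    using d by (intro divide_nonneg_nonneg mult_nonneg_nonneg) auto
  have 1: "norm (?I a p) \<le> ?B"
  proof (cases "a < p")
    case True
    then show ?thesis
      using Suc.prems pq d far by (intro Suc.IH) auto
  qed (use B0 pq in auto)
  have 2: "norm (?I q b) \<le> ?B"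
  proof (cases "q < b")
    case True
    then show ?thesis
      using Suc.prems pq d far by (intro Suc.IH) auto
  qed (use B0 pq in auto)
  have cont: "continuous_on S (\<lambda>x. cis (t * G 0 x))" for S
    by (intro continuous_intros continuous_at_imp_continuous_on ballI DERIV_continuous[OF G])
  have 3: "norm (?I p q) \<le> 4 * d / l"
    using integral_bound[OF pq(2) cont, of 1] pq by simp
  have int: "(\<lambda>x. cis (t * G 0 x)) integrable_on {u..v}" for u v
    by (intro integrable_continuous_real cont)
  have "?I a b = ?I a p + ?I p q + ?I q b"
    using pq by (simp add: Henstock_Kurzweil_Integration.integral_combine[OF _ _ int])
  then have "norm (?I a b) \<le> norm (?I a p) + norm (?I p q) + norm (?I q b)"
    by (metis (no_types) add_right_mono norm_triangle_ineq order_trans)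
  \<comment> \<open>Two outer pieces and a middle one give the recursion c_(k+1) = 2 c_k + 4 with
    c_0 = M + 2, whose solution is the constant (M + 6) 2^k - 4 of the statement.\<close>
  also have "\<dots> \<le> 2 * ?B + 4 * d / l"
    using 1 2 3 by simp
  also have "t powr - (1 / 3 ^ k) = d * d\<^sup>2"
    using t by (simp add: d_def power2_eq_square flip: powr_add)
  also have "2 * (((M + 6) * 2 ^ k - 4) * (d * d\<^sup>2) / d\<^sup>2) + 4 * d / l
      = 2 * ((M + 6) * 2 ^ k - 4) * d + 4 * d / l"
    using d by simp
  also have "\<dots> \<le> 2 * ((M + 6) * 2 ^ k - 4) * (d / l\<^sup>2) + 4 * (d / l\<^sup>2)"
  proof -
    have l2: "l\<^sup>2 \<le> l"
      using Suc.prems by (simp add: power2_eq_square mult_left_le)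
    then have "d / l \<le> d / l\<^sup>2" "d / 1 \<le> d / l\<^sup>2"
      using d Suc.prems by (intro divide_left_mono; simp)+
    then have "4 * (d / l) \<le> 4 * (d / l\<^sup>2)" "2 * ((M + 6) * 2 ^ k - 4) * d \<le> 2 * ((M + 6) * 2 ^ k - 4) * (d / l\<^sup>2)"
      using \<open>(M + 6) * 2 ^ k \<ge> 6 * 1\<close> by (intro mult_left_mono; simp add: mult.commute)+
    then show ?thesis
      by simp
  qed
  also have "\<dots> = ((M + 6) * 2 ^ Suc k - 4) * d / l\<^sup>2"
    by (simp add: algebra_simps add_divide_distrib diff_divide_distrib)
  finally show ?case
    unfolding d_def .
qed

section \<open>Weyl's criterion on the torus\<close>

definition char_torus :: "('k::finite \<Rightarrow> int) \<Rightarrow> real ^ 'k \<Rightarrow> complex" where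
  "char_torus h y = cis (2 * pi * (\<Sum>j\<in>UNIV. of_int (h j) * y $ j))"

lemma char_torus_mult: "char_torus h y * char_torus h' y = char_torus (\<lambda>j. h j + h' j) y"
  by (simp add: char_torus_def cis_mult algebra_simps sum.distrib)

lemma char_torus_0 [simp]: "char_torus (\<lambda>_. 0) y = 1"
  by (simp add: char_torus_def)

lemma continuous_on_char_torus [continuous_intros]: "continuous_on S (char_torus h)"
  unfolding char_torus_def by (intro continuous_intros)

lemma integral_cis_period:
  fixes n :: int
  assumes "n \<noteq> 0"
  shows "integral {0..1} (\<lambda>t. cis (2 * pi * (of_int n * t))) = 0"
proof -
  let ?u = "\<lambda>t. cis (2 * pi * (of_int n * t)) / (2 * pi * of_int n * \<i>)"
  have "(?u has_vector_derivative cis (2 * pi * (of_int n * t))) (at t within {0..1})" for t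
  proof -
    have "((\<lambda>t. 2 * pi * (of_int n * t)) has_derivative (\<lambda>s. 2 * pi * (of_int n * s))) (at t within {0..1})"
      by (intro derivative_intros)
    from has_derivative_cis[OF this]
    have "((\<lambda>t. cis (2 * pi * (of_int n * t))) has_vector_derivative
        2 * pi * of_int n * \<i> * cis (2 * pi * (of_int n * t))) (at t within {0..1})"
      by (simp add: has_vector_derivative_def scaleR_conv_of_real algebra_simps)
    from has_vector_derivative_divide[OF this, of "2 * pi * of_int n * \<i>"] show ?thesis
      using assms by simp
  qed
  then have "((\<lambda>t. cis (2 * pi * (of_int n * t))) has_integral (?u 1 - ?u 0)) {0..1}"
    by (intro fundamental_theorem_of_calculus) auto
  moreover have "cis (2 * pi * (of_int n * 1)) = 1"
    using cis_multiple_2pi[of "of_int n"] by simp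
  ultimately show ?thesis
    by (simp add: has_integral_iff)
qed

text \<open>Fubini's theorem for a product of functions of one coordinate each:
  \<open>lborel\<close> is the image of the product measure under the coordinate map.\<close>

lemma integral_lborel_prod:
  fixes f :: "'a::euclidean_space \<Rightarrow> real \<Rightarrow> complex"
  assumes f: "\<And>b. b \<in> Basis \<Longrightarrow> integrable lborel (f b)"
  shows "(\<integral>y. (\<Prod>b\<in>Basis. f b (y \<bullet> b)) \<partial>lborel) = (\<Prod>b\<in>Basis. integral\<^sup>L lborel (f b))"
proof -
  interpret product_sigma_finite "\<lambda>_ :: 'a. lborel :: real measure"
    by standard
  have [measurable]: "b \<in> Basis \<Longrightarrow> f b \<in> borel_measurable borel" for b
    using borel_measurable_integrable[OF f] by simp
  have "(\<integral>y. (\<Prod>b\<in>Basis. f b (y \<bullet> b)) \<partial>lborel)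
      = (\<integral>z. (\<Prod>b\<in>Basis. f b ((\<Sum>b\<in>Basis. z b *\<^sub>R b) \<bullet> b)) \<partial>(\<Pi>\<^sub>M b\<in>Basis. lborel))"
    by (subst lborel_eq, subst integral_distr) auto
  also have "\<dots> = (\<integral>z. (\<Prod>b\<in>Basis. f b (z b)) \<partial>(\<Pi>\<^sub>M b\<in>Basis. lborel))"
    by simp
  also have "\<dots> = (\<Prod>b\<in>Basis. integral\<^sup>L lborel (f b))"
    by (rule product_integral_prod[OF finite_Basis f])
  finally show ?thesis .
qed

lemma integral_char_torus:
  fixes h :: "'k::finite \<Rightarrow> int"
  assumes "h \<noteq> (\<lambda>_. 0)"
  shows "(\<integral>y. indicator (cbox 0 1) y *\<^sub>R char_torus h y \<partial>lborel) = 0"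
proof -
  obtain i where i: "h i \<noteq> 0"
    using assms by auto
  \<comment> \<open>The product formula is indexed by basis vectors, the character by the indices in
    \<open>'k\<close>; \<open>THE\<close> recovers the index from the basis vector. The cut-off to
    the unit interval sits in each factor, so that the product carries the indicator of the
    cube.\<close>
  define \<phi> where "\<phi> = (\<lambda>(b :: real ^ 'k) t :: real. indicator {0..1} t *\<^sub>R
      cis (2 * pi * (of_int (h (THE j. b = axis j 1)) * t)))"
  have THE: "(THE j. axis i (1::real) = axis j 1) = i" for i :: 'k
    by (auto simp: axis_eq_axis)
  have B: "(Basis :: (real ^ 'k) set) = (\<lambda>j. axis j 1) ` UNIV"
    by (auto simp: Basis_vec_def)
  have inj: "inj (\<lambda>j :: 'k. axis j (1 :: real))"
    by (auto simp: inj_on_def axis_eq_axis)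
  have int: "integrable lborel (\<phi> b)" for b
    unfolding \<phi>_def by (intro borel_integrable_compact continuous_intros) auto
  have "(\<integral>y. indicator (cbox 0 1) y *\<^sub>R char_torus h y \<partial>lborel)
      = (\<integral>y. (\<Prod>b\<in>Basis. \<phi> b (y \<bullet> b)) \<partial>lborel)"
  proof (rule Bochner_Integration.integral_cong)
    fix y :: "real ^ 'k"
    have "(\<Prod>b\<in>Basis. \<phi> b (y \<bullet> b))
        = (\<Prod>j\<in>UNIV. indicator {0..1} (y $ j) *\<^sub>R cis (2 * pi * (of_int (h j) * y $ j)))"
      unfolding B by (subst prod.reindex[OF inj]) (simp add: \<phi>_def THE inner_axis)
    also have "\<dots> = (\<Prod>j\<in>UNIV. of_real (indicator {0..1} (y $ j))) * char_torus h y"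
      by (simp add: scaleR_conv_of_real prod.distrib char_torus_def cis_conv_exp exp_sum[symmetric]
          sum_distrib_left)
    also have "(\<Prod>j\<in>UNIV. of_real (indicator {0..1} (y $ j))) = (of_real (indicator (cbox 0 1) y) :: complex)"
      by (auto simp: indicator_def mem_box_cart prod_zero_iff)
    finally show "indicator (cbox 0 1) y *\<^sub>R char_torus h y = (\<Prod>b\<in>Basis. \<phi> b (y \<bullet> b))"
      by (simp add: scaleR_conv_of_real)
  qed simp
  also have "\<dots> = (\<Prod>b\<in>Basis. integral\<^sup>L lborel (\<phi> b))"
    by (rule integral_lborel_prod[OF int])
  also have "\<dots> = 0"
  proof -
    have "integral\<^sup>L lborel (\<phi> (axis i 1)) = integral {0..1} (\<lambda>t. cis (2 * pi * (of_int (h i) * t)))"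
      using set_borel_integral_eq_integral(2)[OF int[of "axis i 1", unfolded \<phi>_def, folded set_integrable_def]]
      by (simp add: \<phi>_def THE set_lebesgue_integral_def)
    then have "integral\<^sup>L lborel (\<phi> (axis i 1)) = 0"
      using integral_cis_period[OF i] by simp
    moreover have "axis i 1 \<in> (Basis :: (real ^ 'k) set)"
      by (auto simp: Basis_vec_def)
    ultimately show ?thesis
      by (intro prod_zero finite_Basis bexI[of _ "axis i 1"])
  qed
  finally show ?thesis .
qed

text \<open>With the scalar inside the generating clause, addition is the only closure rule.
  Constants are multiples of the trivial character, and closure under products follows from the
  multiplicativity of the characters.\<close>

inductive trig_poly :: "(real ^ 'k \<Rightarrow> complex) \<Rightarrow> bool" where
  char: "trig_poly (\<lambda>y. c * char_torus h y)"
| add: "trig_poly G \<Longrightarrow> trig_poly G' \<Longrightarrow> trig_poly (\<lambda>y. G y + G' y)"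

lemma trig_poly_const: "trig_poly (\<lambda>_. c)"
  using trig_poly.char[of c "\<lambda>_. 0"] by simp

lemma trig_poly_mult_char: "trig_poly G \<Longrightarrow> trig_poly (\<lambda>y. G y * (c * char_torus h y))"
proof (induction rule: trig_poly.induct)
  case (char c' h')
  have "(\<lambda>y. c' * char_torus h' y * (c * char_torus h y))
      = (\<lambda>y. (c' * c) * char_torus (\<lambda>j. h' j + h j) y)"
    by (simp add: char_torus_mult[symmetric] algebra_simps)
  then show ?case
    by (simp only: trig_poly.char)
next
  case (add G G')
  then show ?case
    using trig_poly.add by (simp only: distrib_right)
qed

lemma trig_poly_mult:
  assumes "trig_poly G"
  shows "trig_poly H \<Longrightarrow> trig_poly (\<lambda>y. G y * H y)"
proof (induction rule: trig_poly.induct)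
  case (char c h)
  then show ?case
    using assms by (rule trig_poly_mult_char)
next
  case (add H H')
  then show ?case
    using trig_poly.add by (simp only: distrib_left)
qed

lemma trig_poly_sum:
  assumes "finite I" "\<And>i. i \<in> I \<Longrightarrow> trig_poly (G i)"
  shows "trig_poly (\<lambda>y. \<Sum>i\<in>I. G i y)"
  using assms by (induction I rule: finite_induct) (auto intro: trig_poly.add trig_poly_const)

lemma continuous_on_trig_poly: "trig_poly G \<Longrightarrow> continuous_on S G"
  by (induction rule: trig_poly.induct) (auto intro!: continuous_intros)

text \<open>The torus as a compact subset of complex space. Functions that factor through this map
  are automatically periodic, and polynomials on the ambient space pull back to trigonometric
  polynomials, which puts the Stone-Weierstrass theorem within reach.\<close>

definition torus_embed :: "real ^ 'k \<Rightarrow> complex ^ 'k" where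
  "torus_embed y = (\<chi> j. cis (2 * pi * y $ j))"

lemma continuous_on_torus_embed: "continuous_on S torus_embed"
  unfolding torus_embed_def by (intro continuous_intros)

lemma torus_embed_frac: "torus_embed (\<chi> j. frac (y $ j)) = torus_embed y"
proof -
  have "cis (2 * pi * frac t) = cis (2 * pi * t)" for t :: real
  proof -
    have "cis (2 * pi * t) = cis (2 * pi * of_int \<lfloor>t\<rfloor>) * cis (2 * pi * frac t)"
      by (simp add: cis_mult frac_def algebra_simps)
    then show ?thesis
      by simp
  qed
  then show ?thesis
    by (simp add: torus_embed_def)
qed

lemma frac_vec_in_cube: "(\<chi> j. frac (y $ j)) \<in> cbox 0 (1 :: real ^ 'k)"
  by (auto simp: mem_box_cart frac_lt_1 less_imp_le)

lemma torus_embed_in_torus: "torus_embed y \<in> torus_embed ` cbox 0 1"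
  by (metis frac_vec_in_cube imageI torus_embed_frac)

lemma measure_unit_cube: "measure lborel (cbox 0 (1 :: real ^ 'k)) = 1"
proof -
  have "(1 :: real ^ 'k) \<bullet> b = 1" if "b \<in> Basis" for b
    using that by (auto simp: Basis_vec_def inner_axis)
  then show ?thesis
    by (simp add: measure_lborel_cbox_eq)
qed

lemma integral_unit_cube_const:
  "(\<integral>y. indicator (cbox 0 (1 :: real ^ 'k)) y *\<^sub>R c \<partial>lborel) = (c :: 'b :: {banach, second_countable_topology})"
  by (subst integral_scaleR_left)
    (auto simp: measure_unit_cube intro!: integrable_real_indicator emeasure_lborel_cbox_finite)

text \<open>By Euler's formulas the real coordinates of \<open>torus_embed y\<close> are cosines and
  sines, each a combination of two characters of frequency 1 and -1 in a single variable. Sums and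
  products remain trigonometric polynomials.\<close>

lemma trig_poly_real_polynomial:
  fixes p :: "complex ^ 'k \<Rightarrow> real"
  assumes "real_polynomial_function p"
  shows "trig_poly (\<lambda>y. of_real (p (torus_embed y)))"
  using assms
proof (induction rule: real_polynomial_function.induct)
  case (linear p)
  have t: "trig_poly (\<lambda>y :: real ^ 'k. of_real (torus_embed y \<bullet> b))" if b: "b \<in> Basis" for b
  proof -
    obtain j u where u: "b = axis j u" "u = 1 \<or> u = \<i>"
      using b by (auto simp: Basis_vec_def Basis_complex_def)
    have ch: "char_torus (\<lambda>l. if l = j then m else 0) y = cis (of_int m * (2 * pi * y $ j))" for m and y :: "real ^ 'k"
    proof -
      have "(\<Sum>l\<in>UNIV. of_int (if l = j then m else 0) * y $ l) = (\<Sum>l\<in>UNIV. if l = j then of_int m * y $ l else 0)"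
        by (intro sum.cong) auto
      then show ?thesis
        by (simp add: char_torus_def algebra_simps)
    qed
    show ?thesis
    proof (cases "u = 1")
      case True
      have "(\<lambda>y :: real ^ 'k. of_real (torus_embed y \<bullet> b) :: complex) = (\<lambda>y.
          1 / 2 * char_torus (\<lambda>l. if l = j then 1 else 0) y + 1 / 2 * char_torus (\<lambda>l. if l = j then -1 else 0) y)"
        unfolding ch u(1) True by (auto simp: complex_eq_iff inner_axis torus_embed_def inner_complex_def)
      then show ?thesis
        by (simp only: trig_poly.intros)
    next
      case False
      then have u': "u = \<i>"
        using u by auto
      have "(\<lambda>y :: real ^ 'k. of_real (torus_embed y \<bullet> b) :: complex) = (\<lambda>y.
          (- \<i> / 2) * char_torus (\<lambda>l. if l = j then 1 else 0) y + \<i> / 2 * char_torus (\<lambda>l. if l = j then -1 else 0) y)"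
        unfolding ch u(1) u' by (auto simp: complex_eq_iff inner_axis torus_embed_def inner_complex_def)
      then show ?thesis
        by (simp only: trig_poly.intros)
    qed
  qed
  interpret bounded_linear p by (rule linear)
  have rep: "p z = (\<Sum>b\<in>Basis. (z \<bullet> b) * p b)" for z
    by (subst euclidean_representation[of z, symmetric]) (simp add: sum scale)
  have "(\<lambda>y. of_real (p (torus_embed y)))
      = (\<lambda>y. \<Sum>b\<in>Basis. of_real (torus_embed y \<bullet> b) * (of_real (p b) :: complex))"
    by (rule ext, subst rep) simp
  moreover have "trig_poly (\<lambda>y. \<Sum>b\<in>Basis. of_real (torus_embed y \<bullet> b) * (of_real (p b) :: complex))"
    by (intro trig_poly_sum finite_Basis trig_poly_mult[OF t] trig_poly_const)
  ultimately show ?case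
    by simp
next
  case (add f g)
  then show ?case
    using trig_poly.add by simp
next
  case (mult f g)
  then show ?case
    using trig_poly_mult by simp
qed (simp add: trig_poly_const)

section \<open>From vanishing averages of characters to frequencies in boxes\<close>

context
  fixes x :: "nat \<Rightarrow> real ^ 'k::finite"
  assumes weyl: "\<And>h. h \<noteq> (\<lambda>_. 0) \<Longrightarrow>
    (\<lambda>N. (\<Sum>n\<in>{1..N}. char_torus h (x n)) / of_nat N) \<longlonglongrightarrow> 0"
begin

lemma tendsto_mean_trig_poly:
  "trig_poly G \<Longrightarrow> (\<lambda>N. (\<Sum>n\<in>{1..N}. G (x n)) / of_nat N)
    \<longlonglongrightarrow> (\<integral>y. indicator (cbox 0 1) y *\<^sub>R G y \<partial>lborel)"
proof (induction rule: trig_poly.induct)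
  case (char c h)
  show ?case
  proof (cases "h = (\<lambda>_. 0)")
    case True
    have "\<forall>\<^sub>F N in sequentially. (\<Sum>n\<in>{1..N}. c) / of_nat N = c"
      using eventually_gt_at_top[of 0] by eventually_elim simp
    then have "(\<lambda>N. (\<Sum>n\<in>{1..N}. c) / of_nat N) \<longlonglongrightarrow> c"
      by (rule tendsto_eventually)
    then show ?thesis
      using True by (simp add: integral_unit_cube_const)
  next
    case False
    have "(\<lambda>N. c * ((\<Sum>n\<in>{1..N}. char_torus h (x n)) / of_nat N)) \<longlonglongrightarrow> c * 0"
      by (intro tendsto_intros weyl False)
    moreover have "(\<integral>y. indicator (cbox 0 1) y *\<^sub>R (c * char_torus h y) \<partial>lborel)
        = c * (\<integral>y. indicator (cbox 0 1) y *\<^sub>R char_torus h y \<partial>lborel)"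
      by (subst integral_mult_right_zero[symmetric]) (simp add: algebra_simps)
    ultimately show ?thesis
      using integral_char_torus[OF False] by (simp add: sum_distrib_left)
  qed
next
  case (add G G')
  have int: "integrable lborel (\<lambda>y. indicator (cbox 0 1) y *\<^sub>R H y)" if "trig_poly H" for H :: "real ^ 'k \<Rightarrow> complex"
    using that by (intro borel_integrable_compact continuous_on_trig_poly) auto
  show ?case
    using tendsto_add[OF add.IH] int[OF add.hyps(1)] int[OF add.hyps(2)]
    by (simp add: sum.distrib add_divide_distrib scaleR_add_right)
qed

text \<open>A polynomial within r / 3 of \<open>g\<close> on the compact image of the cube changes
  the averages and, the cube having measure 1, the integral by at most r / 3. All sample points lie
  in that image, whatever their integer parts.\<close>

lemma tendsto_mean_continuous:
  fixes g :: "complex ^ 'k \<Rightarrow> real"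
  assumes g: "continuous_on UNIV g"
  shows "(\<lambda>N. (\<Sum>n\<in>{1..N}. g (torus_embed (x n))) / of_nat N)
    \<longlonglongrightarrow> (\<integral>y. indicator (cbox 0 1) y *\<^sub>R g (torus_embed y) \<partial>lborel)"
    (is "?m g \<longlonglongrightarrow> ?I g")
proof (rule LIMSEQ_I)
  fix r :: real assume r: "0 < r"
  have cp: "continuous_on UNIV p" if "real_polynomial_function p" for p :: "complex ^ 'k \<Rightarrow> real"
    using that continuous_on_polymonial_function real_polynomial_function_eq by blast
  have int: "integrable lborel (\<lambda>y. indicator (cbox 0 1) y *\<^sub>R H (torus_embed y))"
    if "continuous_on UNIV H" for H :: "complex ^ 'k \<Rightarrow> real"
    using that by (intro borel_integrable_compact continuous_on_compose2[OF that continuous_on_torus_embed]) auto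
  have "compact (torus_embed ` cbox 0 (1 :: real ^ 'k))"
    by (intro compact_continuous_image continuous_on_torus_embed compact_cbox)
  moreover have "continuous_on (torus_embed ` cbox 0 1) g"
    using g by (rule continuous_on_subset) simp
  ultimately obtain p where p: "real_polynomial_function p"
    "\<And>z. z \<in> torus_embed ` cbox 0 1 \<Longrightarrow> \<bar>g z - p z\<bar> < r / 3"
    using Stone_Weierstrass_real_polynomial_function[of _ g "r / 3"] r by auto
  note p = p(1) p(2)[OF torus_embed_in_torus]
  have "(\<lambda>N. Re ((\<Sum>n\<in>{1..N}. of_real (p (torus_embed (x n)))) / of_nat N))
      \<longlonglongrightarrow> Re (\<integral>y. indicator (cbox 0 1) y *\<^sub>R of_real (p (torus_embed y)) \<partial>lborel)"
    by (intro tendsto_Re tendsto_mean_trig_poly trig_poly_real_polynomial p)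
  moreover have "(\<integral>y. indicator (cbox 0 1) y *\<^sub>R complex_of_real (p (torus_embed y)) \<partial>lborel) = of_real (?I p)"
    by (subst integral_complex_of_real[symmetric]) (simp add: scaleR_conv_of_real)
  ultimately have "?m p \<longlonglongrightarrow> ?I p"
    by simp
  then obtain N0 where N0: "\<And>N. N0 \<le> N \<Longrightarrow> \<bar>?m p N - ?I p\<bar> < r / 3"
    using LIMSEQ_D[of "?m p" "?I p" "r / 3"] r by auto
  have a: "\<bar>?I p - ?I g\<bar> \<le> r / 3"
  proof -
    have "?I p - ?I g = (\<integral>y. indicator (cbox 0 1) y *\<^sub>R (p (torus_embed y) - g (torus_embed y)) \<partial>lborel)"
      using int[OF g] int[OF cp[OF p(1)]] by (simp add: right_diff_distrib)
    also have "\<bar>\<dots>\<bar> \<le> (\<integral>y. \<bar>indicator (cbox 0 1) y *\<^sub>R (p (torus_embed y) - g (torus_embed y))\<bar> \<partial>lborel)"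
      by (rule integral_abs_bound)
    also have "\<dots> \<le> (\<integral>y. indicator (cbox 0 (1 :: real ^ 'k)) y *\<^sub>R (r / 3) \<partial>lborel)"
    proof (rule integral_mono)
      show "integrable lborel (\<lambda>y. \<bar>indicator (cbox 0 1) y *\<^sub>R (p (torus_embed y) - g (torus_embed y))\<bar>)"
        using int[OF continuous_on_diff[OF cp[OF p(1)] g]] by auto
      show "\<bar>indicator (cbox 0 1) y *\<^sub>R (p (torus_embed y) - g (torus_embed y))\<bar> \<le> indicator (cbox 0 1) y *\<^sub>R (r / 3)" for y
        using p(2)[of y] by (simp add: indicator_def abs_minus_commute)
    qed (intro borel_integrable_compact continuous_intros compact_cbox)
    also have "\<dots> = r / 3"
      by (rule integral_unit_cube_const)
    finally show ?thesis .
  qed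
  have b: "\<bar>?m g N - ?m p N\<bar> \<le> r / 3" for N
  proof -
    have "\<bar>\<Sum>n\<in>{1..N}. g (torus_embed (x n)) - p (torus_embed (x n))\<bar> \<le> real N * (r / 3)"
      using sum_norm_bound[of "{1..N}" "\<lambda>n. g (torus_embed (x n)) - p (torus_embed (x n))" "r / 3"] p(2)
      by (simp add: less_imp_le)
    then show ?thesis
      using r by (cases "N = 0") (simp_all add: sum_subtractf field_simps flip: diff_divide_distrib)
  qed
  have "\<bar>?m g N - ?I g\<bar> < r" if "N0 \<le> N" for N
    using a b[of N] N0[OF that] by linarith
  then show "\<exists>no. \<forall>N\<ge>no. norm (?m g N - ?I g) < r"
    by auto
qed

text \<open>The continuous functions \<open>max 0 (1 - M * infdist z K)\<close> dominate the
  indicator of the closed set \<open>K\<close> and decrease to it. By dominated convergence one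
  fixed \<open>M\<close> has integral below \<open>measure lborel C + r\<close>, and its averages
  bound the frequencies from above.\<close>

lemma eventually_frequency_compact_less:
  assumes C: "compact C" "C \<subseteq> cbox 0 1" and r: "0 < r"
  shows "\<forall>\<^sub>F N in sequentially.
    real (card {n \<in> {1..N}. (\<chi> j. frac (x n $ j)) \<in> C}) / real N < measure lborel C + r"
proof (cases "C = {}")
  case True
  then show ?thesis
    using r by simp
next
  case False
  define K where "K = torus_embed ` C"
  have K: "compact K" "K \<noteq> {}"
    using False C(1) by (auto simp: K_def intro!: compact_continuous_image continuous_on_torus_embed)
  define g where "g = (\<lambda>M :: nat. \<lambda>z. max 0 (1 - real M * infdist z K))"
  have cont: "continuous_on UNIV (g M)" for M
    unfolding g_def by (intro continuous_intros)
  have g01: "0 \<le> g M z" "g M z \<le> 1" for M z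
    by (auto simp: g_def infdist_nonneg)
  have gK: "g M z = 1" if "z \<in> K" for M z
    using that by (simp add: g_def)
  have lim: "(\<lambda>M. g M z) \<longlonglongrightarrow> indicator K z" for z
  proof (cases "z \<in> K")
    case True
    then show ?thesis
      by (simp add: gK)
  next
    case False
    then have pos: "infdist z K > 0"
      using K compact_imp_closed infdist_pos_not_in_closed by blast
    have "g M z = 0" if "1 / infdist z K \<le> real M" for M
      using that pos by (simp add: g_def field_simps max_def)
    then have "\<forall>\<^sub>F M in sequentially. g M z = 0"
      using eventually_ge_at_top[of "nat \<lceil>1 / infdist z K\<rceil>"]
      by (auto elim!: eventually_mono simp: nat_le_iff ceiling_le_iff)
    then show ?thesis
      using False by (simp add: tendsto_eventually)
  qed
  \<comment> \<open>Opposite faces of the cube are identified on the torus, so only interior points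
    are determined by their image. The pullback of the indicator of \<open>K\<close> therefore
    agrees with that of \<open>C\<close> only off the frontier of the cube, a null set.\<close>
  have unique: "y = c" if "y \<in> box 0 1" "c \<in> cbox 0 1" "torus_embed y = torus_embed c" for y c :: "real ^ 'k"
  proof -
    have "y $ j = c $ j" for j
    proof -
      have "cis (2 * pi * y $ j) = cis (2 * pi * c $ j)"
        using that(3) by (simp add: torus_embed_def vec_eq_iff)
      then have "cis (2 * pi * y $ j) / cis (2 * pi * c $ j) = 1"
        by simp
      then have "cos (2 * pi * (y $ j - c $ j)) = 1"
        by (simp add: cis_divide complex_eq_iff algebra_simps)
      then obtain m :: int where "2 * pi * (y $ j - c $ j) = of_int m * 2 * pi"
        by (auto simp: cos_one_2pi_int)
      then have "2 * pi * (y $ j - c $ j) = 2 * pi * of_int m"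
        by (simp only: mult.commute mult.left_commute)
      then have m: "y $ j - c $ j = of_int m"
        by simp
      have "0 < y $ j" "y $ j < 1" "0 \<le> c $ j" "c $ j \<le> 1"
        using that(1,2) by (auto simp: mem_box_cart)
      then have "m = 0"
        using m by linarith
      then show ?thesis
        using m by simp
    qed
    then show ?thesis
      by (simp add: vec_eq_iff)
  qed
  have ae: "AE y in lborel. indicator (cbox 0 1) y *\<^sub>R indicat_real K (torus_embed y) = indicator C y"
  proof -
    have "frontier (cbox 0 (1 :: real ^ 'k)) \<in> null_sets lborel"
      using negligible_convex_frontier[of "cbox 0 (1 :: real ^ 'k)"]
      by (simp add: negligible_iff_null_sets null_sets_completion_iff)
    then have "AE y in lborel. y \<notin> frontier (cbox 0 (1 :: real ^ 'k))"
      by (rule AE_not_in)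
    then show ?thesis
    proof eventually_elim
      case (elim y)
      then have "y \<in> cbox 0 1 \<longleftrightarrow> y \<in> box 0 1"
        using box_subset_cbox by (auto simp: frontier_def interior_cbox)
      then show ?case
        using unique[of y] C(2) by (auto simp: indicator_def K_def)
    qed
  qed
  let ?L = "\<lambda>M. \<integral>y. indicator (cbox 0 1) y *\<^sub>R g M (torus_embed y) \<partial>lborel"
  have Cb: "C \<in> sets borel"
    using C(1) by (simp add: borel_compact)
  have em[measurable]: "torus_embed \<in> borel_measurable (borel :: (real ^ 'k) measure)"
    by (intro borel_measurable_continuous_onI continuous_on_torus_embed)
  have [measurable]: "g M \<in> borel_measurable borel" for M
    by (intro borel_measurable_continuous_onI cont)
  have [measurable]: "K \<in> sets borel"
    using K(1) by (simp add: borel_compact)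
  have "?L \<longlonglongrightarrow> (\<integral>y. indicator (cbox 0 1) y *\<^sub>R indicat_real K (torus_embed y) \<partial>lborel)"
  proof (rule integral_dominated_convergence[where w = "indicator (cbox 0 1)"])
    show "integrable lborel (indicat_real (cbox 0 (1 :: real ^ 'k)))"
      by (intro integrable_real_indicator emeasure_lborel_cbox_finite) auto
    show "AE y in lborel. norm (indicator (cbox 0 1) y *\<^sub>R g M (torus_embed y)) \<le> indicat_real (cbox 0 1) y" for M
      using g01 by (auto simp: indicator_def)
    show "AE y in lborel. (\<lambda>M. indicator (cbox 0 1) y *\<^sub>R g M (torus_embed y))
        \<longlonglongrightarrow> indicator (cbox 0 1) y *\<^sub>R indicat_real K (torus_embed y)"
      by (intro AE_I2 tendsto_scaleR tendsto_const lim)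
  qed measurable
  also have "(\<integral>y. indicator (cbox 0 1) y *\<^sub>R indicat_real K (torus_embed y) \<partial>lborel) = (\<integral>y. indicat_real C y \<partial>lborel)"
    by (intro integral_cong_AE ae borel_measurable_scaleR borel_measurable_indicator'
        borel_measurable_indicator measurable_compose[OF em]) (use Cb in simp_all)
  also have "\<dots> = measure lborel C"
    by simp
  finally have "\<forall>\<^sub>F M in sequentially. ?L M < measure lborel C + r"
    using r by (intro order_tendstoD) auto
  then obtain M where M: "?L M < measure lborel C + r"
    by (auto simp: eventually_sequentially)
  have "\<forall>\<^sub>F N in sequentially. (\<Sum>n\<in>{1..N}. g M (torus_embed (x n))) / real N < measure lborel C + r"
    using tendsto_mean_continuous[OF cont[of M]] M by (rule order_tendstoD)
  then show ?thesis
  proof eventually_elim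
    case (elim N)
    have "real (card {n \<in> {1..N}. (\<chi> j. frac (x n $ j)) \<in> C})
        = (\<Sum>n\<in>{1..N}. of_bool ((\<chi> j. frac (x n $ j)) \<in> C))"
      by (simp add: sum.If_cases of_bool_def Int_def)
    also have "\<dots> \<le> (\<Sum>n\<in>{1..N}. g M (torus_embed (x n)))"
    proof (rule sum_mono)
      fix n
      show "of_bool ((\<chi> j. frac (x n $ j)) \<in> C) \<le> g M (torus_embed (x n))"
      proof (cases "(\<chi> j. frac (x n $ j)) \<in> C")
        case True
        then have "torus_embed (x n) \<in> K"
          unfolding K_def by (metis imageI torus_embed_frac)
        then show ?thesis
          by (simp add: gK)
      qed (simp add: g01)
    qed
    finally show ?case
      using elim by (meson divide_right_mono le_less_trans of_nat_0_le_iff)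
  qed
qed

text \<open>Upper bounds for compact sets suffice: applied to the closure of the box they bound its
  frequency from above, applied to the cube minus its interior they bound it from below. A box is
  convex whichever endpoints its sides contain, so its frontier is negligible and both bounds have
  the same limit.\<close>

lemma weyl_criterion: "uniformly_distributed_mod1 x"
  unfolding uniformly_distributed_mod1_def
proof (intro allI impI)
  fix I :: "'k \<Rightarrow> real set"
  assume I: "\<forall>j. is_interval (I j) \<and> I j \<subseteq> {0..1}"
  define B where "B = {y :: real ^ 'k. \<forall>j. y $ j \<in> I j}"
  have "convex B"
  proof -
    have "B = (\<Inter>j. (\<lambda>y. y $ j) -` I j)"
      by (auto simp: B_def)
    moreover have "convex ((\<lambda>y :: real ^ 'k. y $ j) -` I j)" for j
      using I by (intro convex_linear_vimage linear_componentwise bounded_linear.linear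
          bounded_linear_vec_nth is_interval_convex) auto
    ultimately show ?thesis
      by (simp add: convex_INT)
  qed
  then have neg: "negligible (frontier B)"
    by (rule negligible_convex_frontier)
  have sub: "B \<subseteq> cbox 0 1"
    using I by (fastforce simp: B_def mem_box_cart)
  then have bdd: "bounded B"
    using bounded_cbox bounded_subset by blast
  have clB: "closure B \<subseteq> cbox 0 1"
    by (rule closure_minimal[OF sub closed_cbox])
  have 1: "measure lborel (closure B) = measure lebesgue B"
    using measure_closure[OF bdd neg] by (simp add: measure_completion)
  have 2: "measure lborel (cbox 0 1 - interior B) = 1 - measure lebesgue B"
  proof -
    have "measure lborel (cbox 0 1 - interior B) = measure lborel (cbox 0 (1 :: real ^ 'k)) - measure lborel (interior B)"
      using sub interior_subset[of B]
      by (intro measure_Diff) (auto simp: emeasure_lborel_cbox_eq)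
    also have "measure lborel (interior B) = measure lebesgue B"
      using measure_interior[OF bdd neg] by (simp add: measure_completion)
    finally show ?thesis
      by (simp only: measure_unit_cube)
  qed
  let ?c = "\<lambda>S N. card {n \<in> {1..N}. (\<chi> j. frac (x n $ j)) \<in> S}"
  have "(\<lambda>N. real (?c B N) / real N) \<longlonglongrightarrow> measure lebesgue B"
  proof (rule LIMSEQ_I)
    fix r :: real assume r: "0 < r"
    have "\<forall>\<^sub>F N in sequentially. real (?c (closure B) N) / real N < measure lborel (closure B) + r"
      using bdd clB r by (intro eventually_frequency_compact_less) auto
    moreover have "\<forall>\<^sub>F N in sequentially. real (?c (cbox 0 1 - interior B) N) / real N
        < measure lborel (cbox 0 1 - interior B) + r"
      using r by (intro eventually_frequency_compact_less compact_diff) auto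
    ultimately have "\<forall>\<^sub>F N in sequentially. norm (real (?c B N) / real N - measure lebesgue B) < r"
      using eventually_gt_at_top[of 0]
    proof eventually_elim
      case (elim N)
      have "?c B N \<le> ?c (closure B) N"
        using closure_subset by (intro card_mono) auto
      then have "real (?c B N) / real N \<le> real (?c (closure B) N) / real N"
        by (simp add: divide_right_mono)
      moreover have "{1..N} \<subseteq> {n \<in> {1..N}. (\<chi> j. frac (x n $ j)) \<in> B}
          \<union> {n \<in> {1..N}. (\<chi> j. frac (x n $ j)) \<in> cbox 0 1 - interior B}"
        using frac_vec_in_cube interior_subset by auto
      then have "card {1..N} \<le> ?c B N + ?c (cbox 0 1 - interior B) N"
        by (intro order_trans[OF card_mono card_Un_le]) auto
      then have "real N / real N \<le> real (?c B N) / real N + real (?c (cbox 0 1 - interior B) N) / real N"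
        unfolding add_divide_distrib[symmetric] by (intro divide_right_mono) auto
      ultimately show ?case
        using elim unfolding 1 2 by (auto simp: abs_less_iff)
    qed
    then show "\<exists>no. \<forall>N\<ge>no. norm (real (?c B N) / real N - measure lebesgue B) < r"
      by (simp add: eventually_sequentially)
  qed
  then show "(\<lambda>N. real (card {n \<in> {1..N}. (\<chi> j. frac (x n $ j)) \<in> {y :: real ^ 'k. \<forall>j. y $ j \<in> I j}}) / real N)
      \<longlonglongrightarrow> measure lebesgue {y :: real ^ 'k. \<forall>j. y $ j \<in> I j}"
    unfolding B_def .
qed

end

section \<open>Almost everywhere convergence from mean square bounds\<close>

text \<open>For \<open>M\<close> between N_j and N_(j+1) at most N_(j+1) - N_j further terms of
  modulus at most 1 join the sum, and this number is eventually below (r / 2) N_j.\<close>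

lemma averages_tendsto_0_of_subseq:
  fixes g :: "nat \<Rightarrow> complex" and N :: "nat \<Rightarrow> nat"
  assumes g: "\<And>n. norm (g n) \<le> 1"
    and N: "mono N" "filterlim N at_top at_top" "(\<lambda>j. real (N (Suc j)) / real (N j)) \<longlonglongrightarrow> 1"
    and sub: "(\<lambda>j. (\<Sum>n\<in>{1..N j}. g n) / of_nat (N j)) \<longlonglongrightarrow> 0"
  shows "(\<lambda>M. (\<Sum>n\<in>{1..M}. g n) / of_nat M) \<longlonglongrightarrow> 0"
proof (rule LIMSEQ_I)
  fix r :: real assume r: "0 < r"
  have "\<forall>\<^sub>F j in sequentially. norm ((\<Sum>n\<in>{1..N j}. g n) / of_nat (N j)) < r / 2"
    using tendsto_norm_zero[OF sub] r by (intro order_tendstoD) auto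
  moreover have "\<forall>\<^sub>F j in sequentially. real (N (Suc j)) / real (N j) < 1 + r / 2"
    using N(3) r by (intro order_tendstoD) auto
  moreover have "\<forall>\<^sub>F j in sequentially. 1 \<le> N j"
    using N(2) by (simp add: filterlim_at_top)
  ultimately have "\<forall>\<^sub>F j in sequentially. norm ((\<Sum>n\<in>{1..N j}. g n) / of_nat (N j)) < r / 2 \<and>
      real (N (Suc j)) / real (N j) < 1 + r / 2 \<and> 1 \<le> N j"
    by eventually_elim simp
  then obtain J where J: "\<And>j. J \<le> j \<Longrightarrow> norm ((\<Sum>n\<in>{1..N j}. g n) / of_nat (N j)) < r / 2 \<and>
      real (N (Suc j)) / real (N j) < 1 + r / 2 \<and> 1 \<le> N j"
    by (auto simp: eventually_sequentially)
  have "norm ((\<Sum>n\<in>{1..M}. g n) / of_nat M - 0) < r" if M: "N J \<le> M" for M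
  proof -
    have ex: "\<exists>i. M < N i"
      using N(2) by (metis (no_types, lifting) eventually_gt_at_top eventually_sequentially
          filterlim_iff order_refl)
    \<comment> \<open>The least index with \<open>N i\<close> beyond \<open>M\<close>; it exceeds
      \<open>J\<close>, so it has a predecessor, and \<open>M\<close> lies in the block that starts
      there.\<close>
    define i where "i = (LEAST i. M < N i)"
    have i: "M < N i"
      unfolding i_def using ex by (rule LeastI_ex)
    have "J < i"
      using i M N(1) by (metis linorder_not_le monoD order.strict_trans1)
    then obtain j where j: "i = Suc j" "J \<le> j"
      by (cases i) auto
    have "\<not> M < N j"
      unfolding i_def[symmetric] using j not_less_Least[of j "\<lambda>i. M < N i"] by (simp add: i_def)
    then have jM: "N j \<le> M" "M < N (Suc j)"
      using i j by auto
    have Nj: "1 \<le> N j"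
      using J[OF j(2)] by simp
    have "{1..M} = {1..N j} \<union> {N j<..M}"
      using jM by auto
    then have "(\<Sum>n\<in>{1..M}. g n) = (\<Sum>n\<in>{1..N j}. g n) + (\<Sum>n\<in>{N j<..M}. g n)"
      by (simp add: sum.union_disjoint ivl_disj_int)
    then have "norm (\<Sum>n\<in>{1..M}. g n) \<le> norm (\<Sum>n\<in>{1..N j}. g n) + norm (\<Sum>n\<in>{N j<..M}. g n)"
      by (simp add: norm_triangle_ineq)
    also have "norm (\<Sum>n\<in>{N j<..M}. g n) \<le> real (M - N j)"
      using sum_norm_bound[of "{N j<..M}" g 1] g by simp
    also have "norm (\<Sum>n\<in>{1..N j}. g n) < r / 2 * N j"
      using J[OF j(2)] Nj by (simp add: norm_divide field_simps)
    also have "real (M - N j) \<le> real (N (Suc j)) - real (N j)"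
      using jM by simp
    also have "real (N (Suc j)) < (1 + r / 2) * N j"
      using J[OF j(2)] Nj by (simp add: field_simps)
    finally have "norm (\<Sum>n\<in>{1..M}. g n) < r * N j"
      by (simp add: algebra_simps)
    also have "\<dots> \<le> r * M"
      using jM r by simp
    finally show ?thesis
      using jM Nj by (simp add: norm_divide field_simps)
  qed
  then show "\<exists>no. \<forall>M\<ge>no. norm ((\<Sum>n\<in>{1..M}. g n) / of_nat M - 0) < r"
    by blast
qed

text \<open>Integrating the series of the \<open>h j\<close> term by term gives a finite value, so
  the series converges almost everywhere and its terms tend to 0.\<close>

lemma AE_tendsto_0_of_summable_integral:
  fixes h :: "nat \<Rightarrow> 'a \<Rightarrow> real"
  assumes h: "\<And>j. integrable M (h j)" "\<And>j x. 0 \<le> h j x"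
    and sm: "summable (\<lambda>j. integral\<^sup>L M (h j))"
  shows "AE x in M. (\<lambda>j. h j x) \<longlonglongrightarrow> 0"
proof -
  have meas[measurable]: "h j \<in> borel_measurable M" for j
    using h(1) by auto
  have "(\<integral>\<^sup>+ x. (\<Sum>j. ennreal (h j x)) \<partial>M) = (\<Sum>j. \<integral>\<^sup>+ x. ennreal (h j x) \<partial>M)"
    by (intro nn_integral_suminf) auto
  also have "\<dots> = (\<Sum>j. ennreal (integral\<^sup>L M (h j)))"
    by (intro suminf_cong nn_integral_eq_integral h) (auto simp: h)
  also have "\<dots> = ennreal (\<Sum>j. integral\<^sup>L M (h j))"
    by (intro suminf_ennreal2 sm integral_nonneg_AE) (auto simp: h)
  finally have "(\<integral>\<^sup>+ x. (\<Sum>j. ennreal (h j x)) \<partial>M) \<noteq> \<infinity>"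
    by simp
  then have "AE x in M. (\<Sum>j. ennreal (h j x)) \<noteq> \<infinity>"
    by (intro nn_integral_noteq_infinite) auto
  then show ?thesis
  proof eventually_elim
    case (elim x)
    have "summable (\<lambda>j. h j x)"
      using elim h by (intro summable_suminf_not_top) auto
    then show ?case
      by (rule summable_LIMSEQ_zero)
  qed
qed

lemma AE_averages_tendsto_0:
  fixes g :: "nat \<Rightarrow> 'a \<Rightarrow> complex"
  assumes g: "\<And>n. g n \<in> borel_measurable M" "\<And>n x. norm (g n x) \<le> 1"
    and fin: "finite_measure M"
    and e: "0 < e"
    and bound: "\<forall>\<^sub>F N in sequentially.
      integral\<^sup>L M (\<lambda>x. (norm (\<Sum>n\<in>{1..N}. g n x))\<^sup>2) \<le> C * (real N)\<^sup>2 / ln (real N) powr (1 + e)"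
  shows "AE x in M. (\<lambda>N. (\<Sum>n\<in>{1..N}. g n x) / of_nat N) \<longlonglongrightarrow> 0"
proof -
  interpret finite_measure M by (rule fin)
  text \<open>
    With \<open>1 / (1 + e) < s < 1\<close> the subsequence \<open>N\<close> is sparse enough for \<open>1 / ln (N j) powr (1 + e)\<close> to
    be summable and dense enough for \<open>N (Suc j) / N j\<close> to tend to \<open>1\<close>.
  \<close>
  define s where "s = (1 + e / 2) / (1 + e)"
  have s: "0 < s" "s < 1" "1 < s * (1 + e)"
    using e by (auto simp: s_def field_simps add_pos_pos)
  \<comment> \<open>The logarithm of \<open>N j\<close> is asymptotic to \<open>j powr s\<close>,
    and consecutive exponents differ by about s j^(s-1), which tends to 0 since
    \<open>s < 1\<close>.\<close>
  define N where "N = (\<lambda>j :: nat. nat \<lfloor>exp (real j powr s)\<rfloor>)"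
  have N_mono: "mono N"
    unfolding N_def mono_def using s by (auto intro!: nat_mono floor_mono powr_mono2)
  have N_real: "real (N j) = of_int \<lfloor>exp (real j powr s)\<rfloor>" for j
    unfolding N_def by (simp add: of_nat_nat)
  have lim: "filterlim (\<lambda>j. real_of_int \<lfloor>exp (real j powr s)\<rfloor>) at_top at_top"
    using s by real_asymp
  have N_top: "filterlim N at_top at_top"
    unfolding filterlim_at_top
  proof
    fix Z
    have "\<forall>\<^sub>F j in sequentially. real Z \<le> real (N j)"
      using lim unfolding N_real[symmetric] filterlim_at_top by blast
    then show "\<forall>\<^sub>F j in sequentially. Z \<le> N j"
      by simp
  qed
  have N_ratio: "(\<lambda>j. real (N (Suc j)) / real (N j)) \<longlonglongrightarrow> 1"
    unfolding N_real using s by real_asymp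
  have asymp: "(\<lambda>j. 1 / ln (real (N j)) powr (1 + e)) \<in> O(\<lambda>j. real j powr - (s * (1 + e)))"
    unfolding N_real using s e by real_asymp
  have "summable (\<lambda>j. real j powr - (s * (1 + e)))"
    using s by (simp add: summable_real_powr_iff)
  then have sm: "summable (\<lambda>j. \<bar>C\<bar> * (1 / ln (real (N j)) powr (1 + e)))"
    using summable_comparison_test_bigo[OF _ asymp] by (intro summable_mult) simp
  define h where "h = (\<lambda>j x. (norm ((\<Sum>n\<in>{1..N j}. g n x) / of_nat (N j)))\<^sup>2)"
  have meas[measurable]: "g n \<in> borel_measurable M" for n
    by (rule g)
  have hint: "integrable M (h j)" for j
  proof (rule integrable_const_bound[where B = 1])
    have "norm (\<Sum>n\<in>{1..N j}. g n x) \<le> real (N j)" for x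
      using sum_norm_bound[of "{1..N j}" "\<lambda>n. g n x" 1] g by simp
    then have "norm ((\<Sum>n\<in>{1..N j}. g n x) / of_nat (N j)) \<le> 1" for x
      by (auto simp: norm_divide divide_le_eq_1)
    then show "AE x in M. norm (h j x) \<le> 1"
      by (simp add: h_def power_le_one)
  qed (simp add: h_def)
  have "\<forall>\<^sub>F j in sequentially.
      integral\<^sup>L M (\<lambda>x. (norm (\<Sum>n\<in>{1..N j}. g n x))\<^sup>2) \<le> C * (real (N j))\<^sup>2 / ln (real (N j)) powr (1 + e)"
    by (rule eventually_compose_filterlim[OF bound N_top])
  moreover have "\<forall>\<^sub>F j in sequentially. 1 \<le> N j"
    using N_top by (simp add: filterlim_at_top)
  ultimately have "\<forall>\<^sub>F j in sequentially.
      norm (integral\<^sup>L M (h j)) \<le> \<bar>C\<bar> * (1 / ln (real (N j)) powr (1 + e))"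
  proof eventually_elim
    case (elim j)
    have "integral\<^sup>L M (h j) = integral\<^sup>L M (\<lambda>x. (norm (\<Sum>n\<in>{1..N j}. g n x))\<^sup>2) / (real (N j))\<^sup>2"
      by (simp add: h_def norm_divide power_divide)
    also have "\<dots> \<le> C * (real (N j))\<^sup>2 / ln (real (N j)) powr (1 + e) / (real (N j))\<^sup>2"
      by (intro divide_right_mono elim) simp
    also have "\<dots> = C * (1 / ln (real (N j)) powr (1 + e))"
      using elim by simp
    also have "\<dots> \<le> \<bar>C\<bar> * (1 / ln (real (N j)) powr (1 + e))"
      by (intro mult_right_mono) auto
    finally have "integral\<^sup>L M (h j) \<le> \<bar>C\<bar> * (1 / ln (real (N j)) powr (1 + e))" .
    moreover have "0 \<le> integral\<^sup>L M (h j)"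
      by (intro integral_nonneg_AE) (simp add: h_def)
    ultimately show ?case
      by simp
  qed
  then have "summable (\<lambda>j. integral\<^sup>L M (h j))"
    using sm by (rule summable_comparison_test_ev)
  then have "AE x in M. (\<lambda>j. h j x) \<longlonglongrightarrow> 0"
    by (intro AE_tendsto_0_of_summable_integral hint) (simp add: h_def)
  then show ?thesis
  proof eventually_elim
    case (elim x)
    then have "(\<lambda>j. norm ((\<Sum>n\<in>{1..N j}. g n x) / of_nat (N j))) \<longlonglongrightarrow> 0"
      using tendsto_real_sqrt[OF elim] by (simp add: h_def)
    then have "(\<lambda>j. (\<Sum>n\<in>{1..N j}. g n x) / of_nat (N j)) \<longlonglongrightarrow> 0"
      by (simp only: tendsto_norm_zero_iff)
    then show ?case
      by (intro averages_tendsto_0_of_subseq[OF g(2) N_mono N_top N_ratio])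
  qed
qed

section \<open>Uniform oscillatory bounds for linear combinations\<close>

text \<open>Writing \<open>w\<close> as \<open>t\<close> times a unit vector \<open>u\<close> leaves
  a compact set of directions. The order of a non-vanishing derivative varies with \<open>u\<close>,
  but finitely many orders cover the sphere of \<open>W\<close>, so that one radius, one lower bound
  and the worst of finitely many exponents serve all directions.\<close>

lemma oscillatory_integral_local:
  fixes f :: "'k::finite \<Rightarrow> real \<Rightarrow> real"
  assumes an: "\<And>i. real_analytic (f i)"
    and W: "subspace W" "\<And>w. w \<in> W \<Longrightarrow> (\<lambda>x. \<Sum>i\<in>UNIV. w $ i * f i x) constant_on UNIV \<Longrightarrow> w = 0"
  obtains d C \<alpha> where "0 < d" "d \<le> 1 / 2" "0 \<le> C" "0 < \<alpha>" "\<alpha> \<le> 1"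
    "\<And>w. w \<in> W \<Longrightarrow> 1 \<le> norm w \<Longrightarrow>
      norm (integral {x0 - d..x0 + d} (\<lambda>x. cis (\<Sum>i\<in>UNIV. w $ i * f i x))) \<le> C * norm w powr - \<alpha>"
proof -
  define F where "F = (\<lambda>(u :: real ^ 'k) j x. \<Sum>i\<in>UNIV. u $ i * (deriv ^^ j) (f i) x)"
  have F_DERIV: "(F u j has_real_derivative F u (Suc j) x) (at x)" for u j x
    unfolding F_def by (rule DERIV_sum) (rule DERIV_cmult[OF real_analytic_DERIV_funpow[OF an]])
  define S where "S = W \<inter> sphere 0 1"
  have "compact S"
    unfolding S_def by (intro closed_Int_compact closed_subspace W) simp
  have cont: "continuous_on T (\<lambda>u. F u j x)" for T j x
    unfolding F_def by (intro continuous_intros)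
  \<comment> \<open>If all derivatives of positive order vanished at \<open>x0\<close>, the identity
    theorem for the first derivative would make the combination constant, which \<open>W\<close>
    excludes for a unit vector.\<close>
  have nz: "\<exists>j. F u (Suc j) x0 \<noteq> 0" if "u \<in> S" for u
  proof (rule ccontr)
    assume 0: "\<nexists>j. F u (Suc j) x0 \<noteq> 0"
    let ?g = "\<lambda>x. \<Sum>i\<in>UNIV. u $ i * f i x"
    have g: "real_analytic ?g"
      by (rule real_analytic_linear_combination[OF an])
    have "(deriv ^^ j) (deriv ?g) x0 = 0" for j
    proof -
      have "(deriv ^^ Suc j) ?g x0 = F u (Suc j) x0"
        unfolding deriv_funpow_linear_combination[OF an] F_def ..
      then show ?thesis
        using 0 by (simp add: funpow_Suc_right del: funpow.simps)
    qed
    then have "deriv ?g x = 0" for x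
      by (rule real_analytic_eq_0[OF real_analytic_deriv[OF g]])
    then have "(?g has_real_derivative 0) (at x)" for x
      using real_analytic_DERIV[OF g, of x] by simp
    then have "?g x = ?g y" for x y
      using DERIV_isconst_all by blast
    then have "?g constant_on UNIV"
      unfolding constant_on_def by blast
    then have "u = 0"
      using W(2) that by (auto simp: S_def)
    then show False
      using that by (simp add: S_def)
  qed
  have op: "open {u. F u (Suc j) x0 \<noteq> 0}" for j
    by (intro open_Collect_neq cont continuous_on_const)
  have cover: "S \<subseteq> (\<Union>j\<in>UNIV. {u. F u (Suc j) x0 \<noteq> 0})"
    using nz by auto
  obtain D where D: "finite D" "S \<subseteq> (\<Union>j\<in>D. {u. F u (Suc j) x0 \<noteq> 0})"
    using compactE_image[OF \<open>compact S\<close> op cover] by metis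
  obtain l0 where l0: "0 < l0" "\<And>u. u \<in> S \<Longrightarrow> l0 \<le> (\<Sum>j\<in>D. \<bar>F u (Suc j) x0\<bar>)"
  proof (cases "S = {}")
    case True
    then show ?thesis
      using that[of 1] by simp
  next
    case False
    have "continuous_on S (\<lambda>u. \<Sum>j\<in>D. \<bar>F u (Suc j) x0\<bar>)"
      by (intro continuous_intros cont)
    then obtain u where u: "u \<in> S" "\<And>v. v \<in> S \<Longrightarrow> (\<Sum>j\<in>D. \<bar>F u (Suc j) x0\<bar>) \<le> (\<Sum>j\<in>D. \<bar>F v (Suc j) x0\<bar>)"
      using continuous_attains_inf[OF \<open>compact S\<close> False] by blast
    obtain j where "j \<in> D" "F u (Suc j) x0 \<noteq> 0"
      using u D by blast
    then have "0 < (\<Sum>j\<in>D. \<bar>F u (Suc j) x0\<bar>)"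
      using D by (intro sum_pos2[of _ j]) auto
    then show ?thesis
      using that u by blast
  qed
  \<comment> \<open>Pigeonhole: a sum over \<open>D\<close> that is at least \<open>l0\<close> has a
    term of size at least \<open>l1\<close>. The added 1 makes the inequality strict and keeps the
    denominator positive if \<open>D\<close> is empty.\<close>
  define l1 where "l1 = l0 / (real (card D) + 1)"
  have l1: "0 < l1"
    using l0 by (simp add: l1_def)
  have big: "\<exists>j\<in>D. l1 \<le> \<bar>F u (Suc j) x0\<bar>" if "u \<in> S" for u
  proof (rule ccontr)
    assume "\<not> ?thesis"
    then have "(\<Sum>j\<in>D. \<bar>F u (Suc j) x0\<bar>) \<le> real (card D) * l1"
      by (intro sum_bounded_above) force
    also have "\<dots> < l0"
      using l0(1) by (simp add: l1_def field_simps)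
    finally show False
      using l0(2)[OF that] by simp
  qed
  \<comment> \<open>The orders to be bounded: 2 for the hypothesis of van der Corput's estimate,
    \<open>Suc (Suc j)\<close> to control how the derivative of order \<open>Suc j\<close> varies
    near \<open>x0\<close>.\<close>
  define D' where "D' = insert 2 ((\<lambda>j. Suc (Suc j)) ` D)"
  have ex: "\<exists>B. \<forall>x\<in>{x0 - 1..x0 + 1}. \<bar>(deriv ^^ j) (f i) x\<bar> \<le> B" for i j
  proof -
    have "bounded ((deriv ^^ j) (f i) ` {x0 - 1..x0 + 1})"
      by (intro compact_imp_bounded compact_continuous_image continuous_on_real_analytic_funpow an) simp
    then show ?thesis
      unfolding bounded_iff by auto
  qed
  define B where "B = (\<lambda>i j. SOME B. \<forall>x\<in>{x0 - 1..x0 + 1}. \<bar>(deriv ^^ j) (f i) x\<bar> \<le> B)"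
  have B: "\<bar>(deriv ^^ j) (f i) x\<bar> \<le> B i j" if "x \<in> {x0 - 1..x0 + 1}" for i j x
    using someI_ex[OF ex] that unfolding B_def by blast
  define M where "M = (\<Sum>j\<in>D'. \<Sum>i\<in>UNIV. B i j)"
  have B0: "0 \<le> B i j" for i j
    using B[of x0 j i] by (auto intro: order_trans[OF abs_ge_zero])
  then have M0: "0 \<le> M"
    unfolding M_def by (intro sum_nonneg) auto
  have FM: "\<bar>F u j x\<bar> \<le> M" if "u \<in> S" "x \<in> {x0 - 1..x0 + 1}" "j \<in> D'" for u j x
  proof -
    have "\<bar>u $ i * (deriv ^^ j) (f i) x\<bar> \<le> 1 * B i j" for i
      unfolding abs_mult using that component_le_norm_cart[of u i] B[OF that(2)]
      by (intro mult_mono) (auto simp: S_def)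
    then have "\<bar>F u j x\<bar> \<le> (\<Sum>i\<in>UNIV. B i j)"
      unfolding F_def by (intro order_trans[OF sum_abs] sum_mono) simp
    also have "\<dots> \<le> M"
      unfolding M_def using that(3) D(1) B0
      by (intro member_le_sum[of j D' "\<lambda>j. \<Sum>i\<in>UNIV. B i j"] sum_nonneg) (auto simp: D'_def)
    finally show ?thesis .
  qed
  \<comment> \<open>Within distance \<open>d\<close> the chosen derivative changes by at most
    \<open>M * d\<close>, hence keeps half of \<open>l1\<close>; the cap 1 / 2 makes the interval at
    most 1 long.\<close>
  define d where "d = min (1 / 2) (l1 / (2 * (M + 1)))"
  have d: "0 < d" "d \<le> 1 / 2" "M * d \<le> l1 / 2"
  proof -
    show "0 < d"
      using l1 M0 by (simp add: d_def)
    show "d \<le> 1 / 2"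
      unfolding d_def by (rule min.cobounded1)
    have "M * d \<le> (M + 1) * (l1 / (2 * (M + 1)))"
      using l1 M0 by (intro mult_mono) (auto simp: d_def)
    also have "\<dots> = l1 / 2"
      using M0 by (simp add: divide_simps)
    finally show "M * d \<le> l1 / 2" .
  qed
  define l where "l = min 1 (l1 / 2)"
  have l: "0 < l" "l \<le> 1"
    using l1 by (auto simp: l_def)
  \<comment> \<open>If \<open>S\<close> is empty, \<open>D\<close> may be empty and \<open>K\<close>
    unspecified. This is harmless: \<open>K\<close> is compared only with elements of
    \<open>D\<close>, and one exists as soon as some \<open>w\<close> is given.\<close>
  define K where "K = Max D"
  have K: "j \<le> K" if "j \<in> D" for j
    unfolding K_def using that D(1) by simp
  define C where "C = (M + 6) * 2 ^ K / l\<^sup>2"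
  show ?thesis
  proof (rule that[of d C "1 / 3 ^ K"])
    show "0 \<le> C"
      using M0 by (simp add: C_def)
    fix w assume w: "w \<in> W" "1 \<le> norm w"
    define t where "t = norm w"
    define u where "u = (1 / t) *\<^sub>R w"
    have t: "1 \<le> t"
      using w by (simp add: t_def)
    have u: "u \<in> S"
      using w t W(1) by (auto simp: S_def u_def subspace_scale t_def)
    obtain j where j: "j \<in> D" "l1 \<le> \<bar>F u (Suc j) x0\<bar>"
      using big[OF u] by blast
    have low: "l \<le> \<bar>F u (Suc j) y\<bar>" if y: "y \<in> {x0 - d..x0 + d}" for y
    proof -
      have "norm (F u (Suc j) y - F u (Suc j) x0) \<le> M * norm (y - x0)"
      proof (rule field_differentiable_bound[where S = "{x0 - d..x0 + d}" and f' = "F u (Suc (Suc j))"])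
        show "norm (F u (Suc (Suc j)) z) \<le> M" if "z \<in> {x0 - d..x0 + d}" for z
          using that d u j by (auto intro!: FM simp: D'_def)
      qed (use y d F_DERIV in \<open>auto intro: has_field_derivative_at_within\<close>)
      also have "\<dots> \<le> M * d"
        using y M0 by (intro mult_left_mono) auto
      finally have "\<bar>F u (Suc j) y - F u (Suc j) x0\<bar> \<le> l1 / 2"
        using d by simp
      then have "l1 / 2 \<le> \<bar>F u (Suc j) y\<bar>"
        using j(2) by linarith
      then show ?thesis
        by (simp add: l_def)
    qed
    have "norm (integral {x0 - d..x0 + d} (\<lambda>x. cis (t * F u 0 x)))
        \<le> ((M + 6) * 2 ^ j - 4) * t powr - (1 / 3 ^ j) / l\<^sup>2"
    proof (rule van_der_Corput[where G = "F u", OF F_DERIV])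
      show "\<bar>F u 2 x\<bar> \<le> M" if "x \<in> {x0 - d..x0 + d}" for x
        using that d u by (intro FM) (auto simp: D'_def)
    qed (use d l t low in auto)
    also have "\<dots> \<le> ((M + 6) * 2 ^ K) * t powr - (1 / 3 ^ K) / l\<^sup>2"
    proof (intro divide_right_mono mult_mono)
      have "(M + 6) * 2 ^ j \<le> (M + 6) * 2 ^ K"
        using K[OF j(1)] M0 by (intro mult_left_mono power_increasing) auto
      then show "(M + 6) * 2 ^ j - 4 \<le> (M + 6) * 2 ^ K"
        by simp
      have "(3 :: real) ^ j \<le> 3 ^ K"
        using K[OF j(1)] by (intro power_increasing) auto
      then show "t powr - (1 / 3 ^ j) \<le> t powr - (1 / 3 ^ K)"
        using t by (intro powr_mono) (auto simp: field_simps)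
    qed (use M0 in auto)
    also have "(\<lambda>x. cis (t * F u 0 x)) = (\<lambda>x. cis (\<Sum>i\<in>UNIV. w $ i * f i x))"
      using t by (simp add: F_def u_def sum_distrib_left mult.assoc[symmetric])
    finally show "norm (integral {x0 - d..x0 + d} (\<lambda>x. cis (\<Sum>i\<in>UNIV. w $ i * f i x)))
        \<le> C * norm w powr - (1 / 3 ^ K)"
      by (simp add: C_def t_def)
  qed (use d in auto)
qed

text \<open>The summand of \<open>delta_scattered\<close> as an even function of the difference, so
  that bounds for oscillatory integrals can be stated in the form in which scatteredness sums
  them.\<close>

definition scatter_kernel :: "real \<Rightarrow> real \<Rightarrow> real" where
  "scatter_kernel \<delta> y = (if y = 0 then 1 else min (\<bar>y\<bar> powr - \<delta>) 1)"

lemma constant_on_UNIV_iff: "g constant_on UNIV \<longleftrightarrow> (\<forall>x. g x = g (0 :: 'a :: zero))"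
  unfolding constant_on_def by auto

lemma subspace_constant_combinations:
  fixes f :: "'k::finite \<Rightarrow> real \<Rightarrow> real"
  shows "subspace {c :: real ^ 'k. (\<lambda>x. \<Sum>i\<in>UNIV. c $ i * f i x) constant_on UNIV}"
proof (rule subspaceI)
  fix c c' :: "real ^ 'k"
  assume c: "c \<in> {c. (\<lambda>x. \<Sum>i\<in>UNIV. c $ i * f i x) constant_on UNIV}"
    and c': "c' \<in> {c. (\<lambda>x. \<Sum>i\<in>UNIV. c $ i * f i x) constant_on UNIV}"
  have "(\<Sum>i\<in>UNIV. c $ i * f i x) + (\<Sum>i\<in>UNIV. c' $ i * f i x)
      = (\<Sum>i\<in>UNIV. c $ i * f i 0) + (\<Sum>i\<in>UNIV. c' $ i * f i 0)" for x
    using c[unfolded constant_on_UNIV_iff mem_Collect_eq, rule_format, of x]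
      c'[unfolded constant_on_UNIV_iff mem_Collect_eq, rule_format, of x] by simp
  then show "c + c' \<in> {c. (\<lambda>x. \<Sum>i\<in>UNIV. c $ i * f i x) constant_on UNIV}"
    by (simp add: constant_on_UNIV_iff distrib_right sum.distrib)
next
  fix r and c :: "real ^ 'k"
  assume c: "c \<in> {c. (\<lambda>x. \<Sum>i\<in>UNIV. c $ i * f i x) constant_on UNIV}"
  have "r * (\<Sum>i\<in>UNIV. c $ i * f i x) = r * (\<Sum>i\<in>UNIV. c $ i * f i 0)" for x
    using c[unfolded constant_on_UNIV_iff mem_Collect_eq, rule_format, of x] by simp
  then show "r *\<^sub>R c \<in> {c. (\<lambda>x. \<Sum>i\<in>UNIV. c $ i * f i x) constant_on UNIV}"
    by (simp add: constant_on_UNIV_iff mult.assoc sum_distrib_left)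
qed (simp add: constant_on_UNIV_iff)

text \<open>
  Directions \<open>c\<close> for which \<open>\<Sum>i. c i * f i\<close> is constant contribute only a unimodular factor, so the
  integral is controlled by any component of \<open>c\<close> orthogonal to all of them.
\<close>

lemma oscillatory_integral_bound:
  fixes f :: "'k::finite \<Rightarrow> real \<Rightarrow> real"
  assumes an: "\<And>i. real_analytic (f i)"
    and w0: "\<And>c. (\<lambda>x. \<Sum>i\<in>UNIV. c $ i * f i x) constant_on UNIV \<Longrightarrow> w0 \<bullet> c = 0"
  obtains d C \<alpha> where "0 < d" "0 \<le> C" "0 < \<alpha>" "\<alpha> \<le> 1"
    "\<And>c. norm (integral {x0 - d..x0 + d} (\<lambda>x. cis (\<Sum>i\<in>UNIV. c $ i * f i x)))
      \<le> C * scatter_kernel \<alpha> (w0 \<bullet> c)"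
proof -
  let ?g = "\<lambda>(c :: real ^ 'k) x. \<Sum>i\<in>UNIV. c $ i * f i x"
  define V where "V = {c. ?g c constant_on UNIV}"
  have V: "subspace V"
    unfolding V_def by (rule subspace_constant_combinations)
  have comp: "w = 0" if "w \<in> orthogonal_comp V" "?g w constant_on UNIV" for w
  proof -
    have "orthogonal w w"
      using that unfolding orthogonal_comp_def V_def by blast
    then show "w = 0"
      by (simp add: orthogonal_def)
  qed
  obtain d C \<alpha> where d: "0 < d" "d \<le> 1 / 2" and C: "0 \<le> C" and \<alpha>: "0 < \<alpha>" "\<alpha> \<le> 1"
    and osc: "\<And>w. w \<in> orthogonal_comp V \<Longrightarrow> 1 \<le> norm w \<Longrightarrow>
      norm (integral {x0 - d..x0 + d} (\<lambda>x. cis (?g w x))) \<le> C * norm w powr - \<alpha>"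
    using oscillatory_integral_local[of f "orthogonal_comp V" x0, OF an subspace_orthogonal_comp comp]
    by blast
  \<comment> \<open>The norm of \<open>w0\<close> enters through Cauchy-Schwarz; the added 1 gives
    \<open>A \<ge> 1\<close> even if \<open>w0\<close> is zero, so that
    \<open>A powr \<alpha>\<close> does not shrink the bound at \<open>T = 0\<close>.\<close>
  define A where "A = norm w0 + 1"
  have A: "1 \<le> A" "1 \<le> A powr \<alpha>"
    using \<alpha> by (auto simp: A_def intro!: ge_one_powr_ge_zero)
  have "norm (integral {x0 - d..x0 + d} (\<lambda>x. cis (?g c x))) \<le> (C + 1) * A powr \<alpha> * scatter_kernel \<alpha> (w0 \<bullet> c)"
    for c
  proof -
    obtain y z where yz: "y \<in> span V" "\<And>w. w \<in> span V \<Longrightarrow> orthogonal z w" "c = y + z"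
      using orthogonal_subspace_decomp_exists[of V c] by metis
    have y: "y \<in> V"
      using yz(1) span_eq_iff[THEN iffD2, OF V] by simp
    have z: "z \<in> orthogonal_comp V"
      using yz(2) by (auto simp: orthogonal_comp_def span_base orthogonal_commute)
    define T where "T = w0 \<bullet> c"
    have T: "T = w0 \<bullet> z"
      using y w0 by (simp add: T_def yz(3) inner_add_right V_def)
    have "\<bar>T\<bar> \<le> norm w0 * norm z"
      unfolding T by (rule Cauchy_Schwarz_ineq2)
    also have "\<dots> \<le> A * norm z"
      by (simp add: A_def mult_right_mono)
    finally have TA: "\<bar>T\<bar> \<le> A * norm z" .
    let ?n = "norm (integral {x0 - d..x0 + d} (\<lambda>x. cis (?g c x)))"
    have cont: "continuous_on {x0 - d..x0 + d} (?g c)" for c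
      using continuous_on_real_analytic_funpow[OF an, of _ 0] by (intro continuous_intros) simp
    have n1: "?n \<le> 1"
    proof -
      have "?n \<le> 1 * (x0 + d - (x0 - d))"
        using d by (intro integral_bound continuous_on_cis cont) auto
      then show ?thesis
        using d by simp
    qed
    have nz: "?n \<le> C * norm z powr - \<alpha>" if "1 \<le> norm z"
    proof -
      have "?g y x = ?g y 0" for x
        using y unfolding V_def constant_on_UNIV_iff by blast
      then have "?g c x = ?g y 0 + ?g z x" for x
        by (simp add: yz(3) distrib_right sum.distrib)
      then have "(\<lambda>x. cis (?g c x)) = (\<lambda>x. cis (?g y 0) * cis (?g z x))"
        by (simp add: cis_mult)
      then have "?n = norm (integral {x0 - d..x0 + d} (\<lambda>x. cis (?g z x)))"
        by (simp add: norm_mult)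
      then show ?thesis
        using osc[OF z that] by simp
    qed
    have "?n \<le> (C + 1) * A powr \<alpha> * 1"
      using n1 mult_mono[of 1 "C + 1" 1 "A powr \<alpha>"] A C by simp
    moreover have "?n \<le> (C + 1) * A powr \<alpha> * \<bar>T\<bar> powr - \<alpha>" if T0: "T \<noteq> 0"
    proof (cases "1 \<le> norm z")
      case True
      have "(A * norm z) powr - \<alpha> \<le> \<bar>T\<bar> powr - \<alpha>"
        using TA T0 \<alpha> by (intro powr_mono2') auto
      then have "A powr \<alpha> * (A * norm z) powr - \<alpha> \<le> A powr \<alpha> * \<bar>T\<bar> powr - \<alpha>"
        by (intro mult_left_mono) auto
      moreover have "A powr \<alpha> * (A * norm z) powr - \<alpha> = norm z powr - \<alpha>"
        using A by (simp add: powr_mult powr_minus field_simps)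
      ultimately have "norm z powr - \<alpha> \<le> A powr \<alpha> * \<bar>T\<bar> powr - \<alpha>"
        by simp
      then have "C * norm z powr - \<alpha> \<le> (C + 1) * (A powr \<alpha> * \<bar>T\<bar> powr - \<alpha>)"
        using C by (intro mult_mono) auto
      then show ?thesis
        using nz[OF True] by (simp add: mult.assoc)
    next
      case False
      \<comment> \<open>A short \<open>z\<close> gives no decay, but it keeps \<open>T\<close>
        bounded by \<open>A\<close>; the claimed bound is then at least 1 and the trivial estimate
        suffices.\<close>
      then have "\<bar>T\<bar> \<le> A"
        using mult_left_mono[of "norm z" 1 A] TA A(1) by linarith
      then have "A powr - \<alpha> \<le> \<bar>T\<bar> powr - \<alpha>"
        using T0 \<alpha> by (intro powr_mono2') auto
      then have "A powr \<alpha> * A powr - \<alpha> \<le> A powr \<alpha> * \<bar>T\<bar> powr - \<alpha>"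
        by (intro mult_left_mono) auto
      then have "1 \<le> A powr \<alpha> * \<bar>T\<bar> powr - \<alpha>"
        using A by (simp add: powr_minus field_simps)
      then have "1 * 1 \<le> (C + 1) * (A powr \<alpha> * \<bar>T\<bar> powr - \<alpha>)"
        using C by (intro mult_mono) auto
      then show ?thesis
        using n1 by (simp add: mult.assoc)
    qed
    ultimately show ?thesis
      unfolding scatter_kernel_def T_def[symmetric] by (simp add: min_def)
  qed
  then show ?thesis
    using C A by (intro that[OF d(1) _ \<alpha>, of "(C + 1) * A powr \<alpha>"]) auto
qed

section \<open>Equidistribution\<close>

lemma scatter_kernel_0 [simp]: "scatter_kernel \<delta> 0 = 1"
  by (simp add: scatter_kernel_def)

lemma scatter_kernel_minus [simp]: "scatter_kernel \<delta> (- y) = scatter_kernel \<delta> y"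
  by (simp add: scatter_kernel_def)

lemma delta_scattered_kernel:
  "delta_scattered \<delta> b \<longleftrightarrow> (\<exists>\<epsilon>>0. \<forall>\<^sub>F N in sequentially.
    1 / (real N)\<^sup>2 * (\<Sum>(m, n) \<in> {(m, n). 1 \<le> m \<and> m < n \<and> n \<le> N}. scatter_kernel \<delta> (b n - b m))
      \<le> 1 / ln (real N) powr (1 + \<epsilon>))"
  by (simp add: delta_scattered_def scatter_kernel_def)

text \<open>Expanding a square gives all ordered pairs, whereas scatteredness controls only the
  pairs with m < n; the two triangles are mirror images.\<close>

lemma sum_square_symmetric:
  fixes g :: "nat \<Rightarrow> nat \<Rightarrow> real"
  assumes sym: "\<And>m n. g m n = g n m"
  shows "(\<Sum>m\<in>{1..N}. \<Sum>n\<in>{1..N}. g m n)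
    = (\<Sum>n\<in>{1..N}. g n n) + 2 * (\<Sum>(m, n) \<in> {(m, n). 1 \<le> m \<and> m < n \<and> n \<le> N}. g m n)"
proof -
  define P where "P = {(m, n). 1 \<le> m \<and> m < n \<and> n \<le> N}"
  have "P \<subseteq> {1..N} \<times> {1..N}"
    by (auto simp: P_def)
  then have "finite P"
    by (rule finite_subset) simp
  then have P: "finite P" "finite (prod.swap ` P)"
    by simp_all
  have eq: "{1..N} \<times> {1..N} = (P \<union> prod.swap ` P) \<union> (\<lambda>n. (n, n)) ` {1..N}"
    by (auto simp: P_def image_iff)
  have "(\<Sum>m\<in>{1..N}. \<Sum>n\<in>{1..N}. g m n) = (\<Sum>(m, n)\<in>{1..N} \<times> {1..N}. g m n)"
    by (simp add: sum.cartesian_product)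
  also have "\<dots> = (\<Sum>(m, n)\<in>P \<union> prod.swap ` P. g m n) + (\<Sum>(m, n)\<in>(\<lambda>n. (n, n)) ` {1..N}. g m n)"
    unfolding eq using P by (intro sum.union_disjoint) (auto simp: P_def)
  also have "(\<Sum>(m, n)\<in>P \<union> prod.swap ` P. g m n) = (\<Sum>(m, n)\<in>P. g m n) + (\<Sum>(m, n)\<in>prod.swap ` P. g m n)"
    using P by (intro sum.union_disjoint) (auto simp: P_def)
  also have "(\<Sum>(m, n)\<in>prod.swap ` P. g m n) = (\<Sum>(m, n)\<in>P. g m n)"
    by (subst sum.reindex) (auto simp: case_prod_unfold sym intro!: sum.cong)
  also have "(\<Sum>(m, n)\<in>(\<lambda>n. (n, n)) ` {1..N}. g m n) = (\<Sum>n\<in>{1..N}. g n n)"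
    by (subst sum.reindex) (auto simp: inj_on_def)
  finally show ?thesis
    unfolding P_def by simp
qed

text \<open>The left side is real and its expansion is a complex double sum. The identity is
  therefore proved in the complex numbers, and norms are taken at the end.\<close>

lemma integral_norm_sum_cis_squared_le:
  fixes \<phi> :: "nat \<Rightarrow> real \<Rightarrow> real"
  assumes cont: "\<And>n. continuous_on {p..q} (\<phi> n)"
    and bound: "\<And>m n. norm (integral {p..q} (\<lambda>x. cis (\<phi> m x - \<phi> n x))) \<le> B m n"
  shows "integral\<^sup>L (lebesgue_on {p..q}) (\<lambda>x. (norm (\<Sum>n\<in>{1..N :: nat}. cis (\<phi> n x)))\<^sup>2)
    \<le> (\<Sum>m\<in>{1..N}. \<Sum>n\<in>{1..N}. B m n)"
proof -
  have int: "integrable (lebesgue_on {p..q}) (\<lambda>x. cis (\<phi> m x - \<phi> n x))" for m n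
    by (intro continuous_imp_integrable_real continuous_intros cont)
  have sq: "of_real ((norm (\<Sum>n\<in>{1..N}. cis (\<phi> n x)))\<^sup>2)
      = (\<Sum>m\<in>{1..N}. \<Sum>n\<in>{1..N}. cis (\<phi> m x - \<phi> n x))" for x
    by (simp only: complex_norm_square cnj_sum cis_cnj sum_product cis_mult) simp
  have "of_real (integral\<^sup>L (lebesgue_on {p..q}) (\<lambda>x. (norm (\<Sum>n\<in>{1..N}. cis (\<phi> n x)))\<^sup>2))
      = integral\<^sup>L (lebesgue_on {p..q}) (\<lambda>x. \<Sum>m\<in>{1..N}. \<Sum>n\<in>{1..N}. cis (\<phi> m x - \<phi> n x))"
    by (subst integral_complex_of_real[symmetric]) (simp only: sq)
  also have "\<dots> = (\<Sum>m\<in>{1..N}. \<Sum>n\<in>{1..N}. integral {p..q} (\<lambda>x. cis (\<phi> m x - \<phi> n x)))"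
    using int by (simp add: Bochner_Integration.integral_sum lebesgue_integral_eq_integral)
  finally have eq: "of_real (integral\<^sup>L (lebesgue_on {p..q}) (\<lambda>x. (norm (\<Sum>n\<in>{1..N}. cis (\<phi> n x)))\<^sup>2))
      = (\<Sum>m\<in>{1..N}. \<Sum>n\<in>{1..N}. integral {p..q} (\<lambda>x. cis (\<phi> m x - \<phi> n x)))" .
  have "integral\<^sup>L (lebesgue_on {p..q}) (\<lambda>x. (norm (\<Sum>n\<in>{1..N}. cis (\<phi> n x)))\<^sup>2)
      \<le> norm (complex_of_real (integral\<^sup>L (lebesgue_on {p..q}) (\<lambda>x. (norm (\<Sum>n\<in>{1..N}. cis (\<phi> n x)))\<^sup>2)))"
    by simp
  also have "\<dots> \<le> (\<Sum>m\<in>{1..N}. \<Sum>n\<in>{1..N}. B m n)"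
    unfolding eq by (intro sum_norm_le bound)
  finally show ?thesis .
qed

text \<open>Negligibility is a local property, since countably many neighbourhoods suffice for a
  cover. The radius may thus depend on the point, as it does in the oscillatory bounds.\<close>

lemma AE_lebesgue_local:
  fixes P :: "real \<Rightarrow> bool"
  assumes "\<And>x0. \<exists>d>0. AE x in lebesgue_on {x0 - d..x0 + d}. P x"
  shows "AE x in lebesgue. P x"
proof -
  have "negligible {x. \<not> P x}"
  proof (subst locally_negligible_alt, intro ballI)
    fix x0 assume x0: "x0 \<in> {x. \<not> P x}"
    obtain d where d: "d > 0" and ae: "AE x in lebesgue_on {x0 - d..x0 + d}. P x"
      using assms by blast
    from ae have "AE x in lebesgue. x \<in> {x0 - d..x0 + d} \<longrightarrow> P x"
      by (subst (asm) AE_restrict_space_iff) auto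
    then obtain N where N: "{x \<in> space lebesgue. \<not> (x \<in> {x0 - d..x0 + d} \<longrightarrow> P x)} \<subseteq> N" "N \<in> null_sets lebesgue"
      by (auto simp: eventually_ae_filter)
    let ?U = "{x. \<not> P x} \<inter> {x0 - d<..<x0 + d}"
    have "negligible ?U"
      by (rule negligible_subset[of N]) (use N in \<open>auto simp: negligible_iff_null_sets\<close>)
    moreover have "openin (top_of_set {x. \<not> P x}) ?U"
      by (intro openin_open_Int) simp
    moreover have "x0 \<in> ?U"
      using x0 d by simp
    ultimately show "\<exists>U. openin (top_of_set {x. \<not> P x}) U \<and> x0 \<in> U \<and> negligible U"
      by blast
  qed
  then have "AE x in lebesgue. x \<notin> {x. \<not> P x}"
    by (intro AE_not_in) (simp add: negligible_iff_null_sets)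
  then show ?thesis
    by simp
qed

text \<open>Near each point the oscillatory bound supplies its own \<open>\<alpha>\<close> in (0,
  1], and the scatteredness of \<open>b\<close> is used for exactly this value. The phase
  differences have coefficient vectors \<open>c\<close> with
  \<open>w0 \<bullet> c = b m - b n\<close>, so their integrals are bounded by the kernel of
  \<open>b\<close>.\<close>

lemma AE_weyl_sum_tendsto_0:
  fixes f :: "'k::finite \<Rightarrow> real \<Rightarrow> real" and a :: "'k \<Rightarrow> nat \<Rightarrow> real"
  assumes an: "\<And>i. real_analytic (f i)"
    and w0: "\<And>c. (\<lambda>x. \<Sum>i\<in>UNIV. c $ i * f i x) constant_on UNIV \<Longrightarrow> w0 \<bullet> c = 0"
    and sc: "scattered (\<lambda>n. \<Sum>i\<in>UNIV. (w0 $ i * (2 * pi * of_int (h i))) * a i n)"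
  shows "AE x in lebesgue. (\<lambda>N. (\<Sum>n\<in>{1..N}. char_torus h (\<chi> i. a i n * f i x)) / of_nat N) \<longlonglongrightarrow> 0"
proof (rule AE_lebesgue_local)
  fix x0
  define b where "b = (\<lambda>n. \<Sum>i\<in>UNIV. (w0 $ i * (2 * pi * of_int (h i))) * a i n)"
  define \<phi> where "\<phi> = (\<lambda>n x. 2 * pi * (\<Sum>i\<in>UNIV. of_int (h i) * (a i n * f i x)))"
  obtain d C \<alpha> where d: "0 < d" and C: "0 \<le> C" and \<alpha>: "0 < \<alpha>" "\<alpha> \<le> 1"
    and osc: "\<And>c. norm (integral {x0 - d..x0 + d} (\<lambda>x. cis (\<Sum>i\<in>UNIV. c $ i * f i x)))
      \<le> C * scatter_kernel \<alpha> (w0 \<bullet> c)"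
    using oscillatory_integral_bound[of f w0 x0, OF an w0] by blast
  have cont: "continuous_on S (\<phi> n)" for S n
    unfolding \<phi>_def using continuous_on_real_analytic_funpow[OF an, of _ 0]
    by (intro continuous_intros) simp
  have bound: "norm (integral {x0 - d..x0 + d} (\<lambda>x. cis (\<phi> m x - \<phi> n x))) \<le> C * scatter_kernel \<alpha> (b n - b m)"
    for m n
  proof -
    define c :: "real ^ 'k" where "c = (\<chi> i. 2 * pi * of_int (h i) * (a i m - a i n))"
    have "(\<lambda>x. cis (\<phi> m x - \<phi> n x)) = (\<lambda>x. cis (\<Sum>i\<in>UNIV. c $ i * f i x))"
      by (simp add: \<phi>_def c_def sum_distrib_left algebra_simps flip: sum_subtractf)
    moreover have "w0 \<bullet> c = b m - b n"
      by (simp add: b_def c_def inner_vec_def algebra_simps flip: sum_subtractf)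
    moreover have "scatter_kernel \<alpha> (b m - b n) = scatter_kernel \<alpha> (b n - b m)"
      using scatter_kernel_minus[of \<alpha> "b n - b m"] by simp
    ultimately show ?thesis
      using osc[of c] by simp
  qed
  obtain e where e: "0 < e" and sce: "\<forall>\<^sub>F N in sequentially.
    1 / (real N)\<^sup>2 * (\<Sum>(m, n) \<in> {(m, n). 1 \<le> m \<and> m < n \<and> n \<le> N}. scatter_kernel \<alpha> (b n - b m))
      \<le> 1 / ln (real N) powr (1 + e)"
    using sc \<alpha> unfolding scattered_def delta_scattered_kernel b_def[symmetric] by force
  \<comment> \<open>The diagonal contributes N, as the kernel is 1 at 0. This is absorbed into the
    bound, and together with the two triangles it accounts for the factor 3.\<close>
  have "\<forall>\<^sub>F N in sequentially. real N \<le> (real N)\<^sup>2 / ln (real N) powr (1 + e)"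
    using e by real_asymp
  then have "\<forall>\<^sub>F N in sequentially.
      integral\<^sup>L (lebesgue_on {x0 - d..x0 + d}) (\<lambda>x. (norm (\<Sum>n\<in>{1..N}. cis (\<phi> n x)))\<^sup>2)
        \<le> (3 * C) * (real N)\<^sup>2 / ln (real N) powr (1 + e)"
    using sce eventually_gt_at_top[of 0]
  proof eventually_elim
    case (elim N)
    let ?P = "\<Sum>(m, n) \<in> {(m, n). 1 \<le> m \<and> m < n \<and> n \<le> N}. scatter_kernel \<alpha> (b n - b m)"
    have "integral\<^sup>L (lebesgue_on {x0 - d..x0 + d}) (\<lambda>x. (norm (\<Sum>n\<in>{1..N}. cis (\<phi> n x)))\<^sup>2)
        \<le> (\<Sum>m\<in>{1..N}. \<Sum>n\<in>{1..N}. C * scatter_kernel \<alpha> (b n - b m))"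
      by (rule integral_norm_sum_cis_squared_le[OF cont bound])
    also have "\<dots> = C * (\<Sum>m\<in>{1..N}. \<Sum>n\<in>{1..N}. scatter_kernel \<alpha> (b n - b m))"
      by (simp only: sum_distrib_left)
    also have "(\<Sum>m\<in>{1..N}. \<Sum>n\<in>{1..N}. scatter_kernel \<alpha> (b n - b m)) = real N + 2 * ?P"
    proof (subst sum_square_symmetric)
      show "scatter_kernel \<alpha> (b n - b m) = scatter_kernel \<alpha> (b m - b n)" for m n
        using scatter_kernel_minus[of \<alpha> "b m - b n"] by simp
    qed simp
    also have "C * (real N + 2 * ?P) \<le> C * (3 * ((real N)\<^sup>2 / ln (real N) powr (1 + e)))"
    proof -
      have "?P \<le> (real N)\<^sup>2 / ln (real N) powr (1 + e)"
        using elim(2,3) by (simp add: field_simps)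
      then show ?thesis
        using elim(1) C by (intro mult_left_mono) auto
    qed
    finally show ?case
      by (simp add: mult_ac)
  qed
  then have "AE x in lebesgue_on {x0 - d..x0 + d}. (\<lambda>N. (\<Sum>n\<in>{1..N}. cis (\<phi> n x)) / of_nat N) \<longlonglongrightarrow> 0"
    using e by (intro AE_averages_tendsto_0[where e = e and C = "3 * C"] finite_measure_lebesgue_on
        continuous_imp_measurable_on_sets_lebesgue continuous_intros cont) auto
  then show "\<exists>d>0. AE x in lebesgue_on {x0 - d..x0 + d}.
      (\<lambda>N. (\<Sum>n\<in>{1..N}. char_torus h (\<chi> i. a i n * f i x)) / of_nat N) \<longlonglongrightarrow> 0"
    using d by (auto simp: char_torus_def \<phi>_def)
qed

section \<open>The choice of the scattered direction, and the conclusion\<close>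

lemma lin_indep_adjoin_one_constant:
  fixes f :: "'k::finite \<Rightarrow> real \<Rightarrow> real"
  assumes "lin_indep_family (adjoin_one f)" "(\<lambda>x. \<Sum>i\<in>UNIV. c $ i * f i x) constant_on UNIV"
  shows "c = 0"
proof -
  obtain e where e: "\<And>x. (\<Sum>i\<in>UNIV. c $ i * f i x) = e"
    using assms(2) by (auto simp: constant_on_def)
  \<comment> \<open>The constant value \<open>e\<close> is moved to the other side as the
    coefficient of the function 1.\<close>
  define c' where "c' = (\<lambda>j. case j of None \<Rightarrow> - e | Some i \<Rightarrow> c $ i)"
  have "(\<Sum>j\<in>UNIV. c' j * adjoin_one f j x) = 0" for x
  proof -
    have "(\<Sum>j\<in>UNIV. c' j * adjoin_one f j x) = - e + (\<Sum>i\<in>UNIV. c $ i * f i x)"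
      by (simp add: UNIV_option_conv sum.reindex c'_def adjoin_one_def)
    then show ?thesis
      using e by simp
  qed
  then have "c' j = 0" for j
    using assms(1) unfolding lin_indep_family_def by blast
  then have "c $ i = 0" for i
    by (metis c'_def option.simps(5))
  then show ?thesis
    by (simp add: vec_eq_iff)
qed

text \<open>With linear independence no non-zero combination is constant, the orthogonality
  condition is void, and a multiple of a unit vector turns the combined sequence into
  \<open>a i0\<close>. Otherwise joint scatteredness admits any non-zero coefficient vector, and the
  projection of a unit vector provides one that respects the orthogonality.\<close>

lemma ex_scattered_direction:
  fixes f :: "'k::finite \<Rightarrow> real \<Rightarrow> real" and a :: "'k \<Rightarrow> nat \<Rightarrow> real"
  assumes nc: "\<And>i. \<not> f i constant_on UNIV"
    and sc: "\<And>i. scattered (a i)"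
    and alt: "jointly_scattered a \<or> lin_indep_family (adjoin_one f)"
    and \<mu>: "\<mu> i0 \<noteq> 0"
  obtains w0 :: "real ^ 'k" where
    "\<And>c. (\<lambda>x. \<Sum>i\<in>UNIV. c $ i * f i x) constant_on UNIV \<Longrightarrow> w0 \<bullet> c = 0"
    "scattered (\<lambda>n. \<Sum>i\<in>UNIV. (w0 $ i * \<mu> i) * a i n)"
proof (cases "lin_indep_family (adjoin_one f)")
  case True
  have "(\<Sum>i\<in>UNIV. ((axis i0 (1 / \<mu> i0) :: real ^ 'k) $ i * \<mu> i) * a i n) = a i0 n" for n
  proof -
    have "(\<Sum>i\<in>UNIV. ((axis i0 (1 / \<mu> i0) :: real ^ 'k) $ i * \<mu> i) * a i n) = (\<Sum>i\<in>UNIV. if i = i0 then a i n else 0)"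
      using \<mu> by (intro sum.cong) (auto simp: axis_def)
    then show ?thesis
      by simp
  qed
  moreover have "axis i0 (1 / \<mu> i0) \<bullet> c = 0" if "(\<lambda>x. \<Sum>i\<in>UNIV. c $ i * f i x) constant_on UNIV" for c
    using lin_indep_adjoin_one_constant[OF True that] by simp
  ultimately show ?thesis
    using sc[of i0] by (intro that[of "axis i0 (1 / \<mu> i0)"]) simp_all
next
  case False
  then have joint: "jointly_scattered a"
    using alt by blast
  define V where "V = {c :: real ^ 'k. (\<lambda>x. \<Sum>i\<in>UNIV. c $ i * f i x) constant_on UNIV}"
  obtain y z where yz: "y \<in> span V" "\<And>w. w \<in> span V \<Longrightarrow> orthogonal z w" "axis i0 1 = y + z"
    using orthogonal_subspace_decomp_exists[of V "axis i0 1"] by metis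
  have V: "subspace V"
    unfolding V_def by (rule subspace_constant_combinations)
  have "axis i0 1 \<notin> V"
  proof
    assume "axis i0 1 \<in> V"
    moreover have "(\<Sum>i\<in>UNIV. (axis i0 1 :: real ^ 'k) $ i * f i x) = f i0 x" for x
    proof -
      have "(\<Sum>i\<in>UNIV. (axis i0 1 :: real ^ 'k) $ i * f i x) = (\<Sum>i\<in>UNIV. if i = i0 then f i x else 0)"
        by (intro sum.cong) (auto simp: axis_def)
      then show ?thesis
        by simp
    qed
    ultimately show False
      using nc[of i0] by (simp add: V_def)
  qed
  then have "z \<noteq> 0"
    using yz(1,3) span_eq_iff[THEN iffD2, OF V] by auto
  \<comment> \<open>Other entries of \<open>\<mu>\<close> may be zero, so
    \<open>z \<noteq> 0\<close> alone would not do. The \<open>i0\<close> coordinate of the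
    projection of the \<open>i0\<close>-th unit vector is the square of its norm, hence
    non-zero.\<close>
  have "z $ i0 = z \<bullet> axis i0 1"
    by (simp add: inner_axis)
  also have "\<dots> = z \<bullet> z"
    using yz(2)[OF yz(1)] by (simp add: yz(3) inner_add_right orthogonal_def)
  finally have "z $ i0 \<noteq> 0"
    using \<open>z \<noteq> 0\<close> by simp
  then have "(\<chi> i. z $ i * \<mu> i) \<noteq> 0"
    using \<mu> by (auto simp: vec_eq_iff)
  then have "scattered (\<lambda>n. \<Sum>i\<in>UNIV. (\<chi> i. z $ i * \<mu> i) $ i * a i n)"
    using joint unfolding jointly_scattered_def by blast
  then have "scattered (\<lambda>n. \<Sum>i\<in>UNIV. (z $ i * \<mu> i) * a i n)"
    by simp
  moreover have "z \<bullet> c = 0" if "(\<lambda>x. \<Sum>i\<in>UNIV. c $ i * f i x) constant_on UNIV" for c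
    using yz(2)[of c] that span_base[of c V] by (simp add: V_def orthogonal_def)
  ultimately show ?thesis
    by (intro that)
qed

theorem theorem1p7:
  fixes f :: "'k::finite \<Rightarrow> real \<Rightarrow> real"
    and a :: "'k \<Rightarrow> nat \<Rightarrow> real"
  assumes "\<And>i. real_analytic (f i)"
    and "\<And>i. \<not> f i constant_on UNIV"
    and "\<And>i. scattered (a i)"
    and "jointly_scattered a \<or> lin_indep_family (adjoin_one f)"
  shows "AE x in lebesgue. uniformly_distributed_mod1 (\<lambda>n. \<chi> i. a i n * f i x)"
proof -
  have "AE x in lebesgue. h \<noteq> (\<lambda>_. 0) \<longrightarrow>
      (\<lambda>N. (\<Sum>n\<in>{1..N}. char_torus h (\<chi> i. a i n * f i x)) / of_nat N) \<longlonglongrightarrow> 0" for h :: "'k \<Rightarrow> int"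
  proof (cases "h = (\<lambda>_. 0)")
    case False
    then obtain i0 where i0: "2 * pi * of_int (h i0) \<noteq> 0"
      by auto
    show ?thesis
    proof (rule ex_scattered_direction[of f a "\<lambda>i. 2 * pi * of_int (h i)" i0, OF assms(2,3,4) i0])
      fix w0 :: "real ^ 'k"
      assume w0: "\<And>c. (\<lambda>x. \<Sum>i\<in>UNIV. c $ i * f i x) constant_on UNIV \<Longrightarrow> w0 \<bullet> c = 0"
        and sc: "scattered (\<lambda>n. \<Sum>i\<in>UNIV. (w0 $ i * (2 * pi * of_int (h i))) * a i n)"
      show ?thesis
        using AE_weyl_sum_tendsto_0[of f w0 h a, OF assms(1) w0 sc] by simp
    qed
  qed simp
  \<comment> \<open>Each \<open>h\<close> has its own exceptional null set; there are only countably
    many integer vectors, so one null set serves them all.\<close>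
  then have "AE x in lebesgue. \<forall>h :: 'k \<Rightarrow> int. h \<noteq> (\<lambda>_. 0) \<longrightarrow>
      (\<lambda>N. (\<Sum>n\<in>{1..N}. char_torus h (\<chi> i. a i n * f i x)) / of_nat N) \<longlonglongrightarrow> 0"
    by (simp add: AE_all_countable)
  then show ?thesis
    by eventually_elim (blast intro: weyl_criterion)
qed

end
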